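(* Let $n=2k$, let $\tau$ be an integer with $1\le\tau\le k$, and let $r$ be an integer with $1<r<k$ and $\gcd(r,k)=1$. Let $\{u_1,\ldots,u_k\}$ be a basis of $\mathbb{F}_{2^k}$ over $\mathbb{F}_2$ and $G(x)=\sum_{i=1}^{2^r-1}x^{(i2^{k-r}+1)(2^k-1)+1}$ (an $(n,k)$-function). Let $F(X_1,\ldots,X_\tau)$ be a reduced polynomial in $\mathbb{F}_2[X_1,\ldots,X_\tau]$ of algebraic degree $d$ and $\{i_1,\ldots,i_\tau\}\subseteq\{1,\ldots,k\}$. Then $H(x)=G(x)+F(\mathrm{Tr}^n_1(u_{i_1}x),\ldots,\mathrm{Tr}^n_1(u_{i_\tau}x))$ is a vectorial bent $(n,k)$-function. Furthermore, if $d=k$ and the algebraic degree of $G$ is not equal to $k$, then $H$ has algebraic degree $k$.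
   Context: $\mathrm{Tr}^m_1(x)=\sum_{i=0}^{m-1}x^{2^i}$. An $(n,k)$-function $H$ is vectorial bent if $\mathrm{Tr}^k_1(\lambda H(x))$ is a bent Boolean function for every $\lambda\in\mathbb{F}_{2^k}^*$ (bent: $|\sum_x(-1)^{f(x)+\mathrm{Tr}^n_1(ax)}|=2^{n/2}$ for all $a$). A reduced polynomial is a multilinear polynomial $\sum_I a_I\prod_{i\in I}X_i$ over $\mathbb{F}_2$, with algebraic degree the largest $|I|$ with $a_I\ne0$. The algebraic degree of a vectorial function is the maximal algebraic degree of its coordinate Boolean functions. *)

theory Defs
  imports Complex_Main
begin

definition tr :: "nat \<Rightarrow> 'a::field \<Rightarrow> 'a" where
  "tr m x = (\<Sum>i<m. x ^ (2 ^ i))"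

text \<open>Sign character of a GF(2)-valued element (0 or 1 in the field).\<close>
definition chi :: "'a::field \<Rightarrow> real" where
  "chi y = (if y = 0 then 1 else -1)"

text \<open>Bent Boolean function on GF(2^n) (values 0/1 in the field).\<close>
definition bent :: "nat \<Rightarrow> ('a::{field,finite} \<Rightarrow> 'a) \<Rightarrow> bool" where
  "bent n f \<longleftrightarrow> (\<forall>a::'a. \<bar>\<Sum>x\<in>UNIV. chi (f x + tr n (a * x))\<bar> = 2 ^ (n div 2))"

definition subfld :: "nat \<Rightarrow> 'a::field set" where
  "subfld k = {y. y ^ (2 ^ k) = y}"

definition vbent :: "nat \<Rightarrow> nat \<Rightarrow> ('a::{field,finite} \<Rightarrow> 'a) \<Rightarrow> bool" where
  "vbent n k H \<longleftrightarrow> (\<forall>lam \<in> subfld k - {0}. bent n (\<lambda>x. tr k (lam * H x)))"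

definition coeffvecs :: "nat \<Rightarrow> (nat \<Rightarrow> bool) set" where
  "coeffvecs m = {c. \<forall>i. c i \<longrightarrow> i \<in> {1..m}}"

definition lincomb :: "nat \<Rightarrow> (nat \<Rightarrow> 'a::field) \<Rightarrow> (nat \<Rightarrow> bool) \<Rightarrow> 'a" where
  "lincomb m v c = (\<Sum>i\<in>{1..m}. if c i then v i else 0)"

definition is_basis :: "nat \<Rightarrow> 'a::field set \<Rightarrow> (nat \<Rightarrow> 'a) \<Rightarrow> bool" where
  "is_basis m S v \<longleftrightarrow> (\<forall>i\<in>{1..m}. v i \<in> S) \<and> bij_betw (lincomb m v) (coeffvecs m) S"

definition coord :: "nat \<Rightarrow> (nat \<Rightarrow> 'a::field) \<Rightarrow> 'a \<Rightarrow> nat \<Rightarrow> bool" where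
  "coord m v x = (THE c. c \<in> coeffvecs m \<and> lincomb m v c = x)"

text \<open>Reduced (multilinear) polynomial over GF(2) in X_1..X_m, given by its
  coefficient function on monomials I \<subseteq> {1..m}; evaluated at field points.\<close>
definition reduced_eval :: "nat \<Rightarrow> (nat set \<Rightarrow> bool) \<Rightarrow> (nat \<Rightarrow> 'a::field) \<Rightarrow> 'a" where
  "reduced_eval m a X = (\<Sum>I\<in>Pow {1..m}. if a I then (\<Prod>j\<in>I. X j) else 0)"

definition is_reduced :: "nat \<Rightarrow> (nat set \<Rightarrow> bool) \<Rightarrow> bool" where
  "is_reduced m a \<longleftrightarrow> (\<forall>I. a I \<longrightarrow> I \<subseteq> {1..m})"

definition poly_deg :: "nat \<Rightarrow> (nat set \<Rightarrow> bool) \<Rightarrow> nat" where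
  "poly_deg m a = Max ({card I | I. I \<in> Pow {1..m} \<and> a I} \<union> {0})"

text \<open>Algebraic degree of a Boolean function f on GF(2^n) (values 0/1), via its
  algebraic normal form in the coordinates w.r.t. the basis v of GF(2^n).\<close>
definition bool_deg :: "nat \<Rightarrow> (nat \<Rightarrow> 'a::field) \<Rightarrow> ('a \<Rightarrow> 'a) \<Rightarrow> nat" where
  "bool_deg n v f = poly_deg n (THE a. is_reduced n a \<and>
      (\<forall>x. f x = reduced_eval n a (\<lambda>j. if coord n v x j then 1 else 0)))"

text \<open>Algebraic degree of an (n,k)-function: maximal degree of its coordinate
  functions w.r.t. the basis u of GF(2^k); input coordinates w.r.t. a fixed
  (arbitrary) GF(2)-basis of GF(2^n) (the degree does not depend on it).\<close>
definition vec_deg :: "nat \<Rightarrow> nat \<Rightarrow> (nat \<Rightarrow> 'a::field) \<Rightarrow> ('a \<Rightarrow> 'a) \<Rightarrow> nat" where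
  "vec_deg n k u H = Max {bool_deg n (SOME v. is_basis n UNIV v)
        (\<lambda>x. if coord k u (H x) i then 1 else 0) | i. i \<in> {1..k}}"

end

theory Submission
  imports Defs "HOL-Computational_Algebra.Polynomial"
begin

text \<open>
  Write \<open>K\<close> for the subfield of order \<open>q = 2 ^ k\<close> and fix \<open>\<theta>\<close> with \<open>\<theta> + \<theta> ^ q = 1\<close>. Summing the
  geometric progression shows that, with \<open>P = 2 ^ (k - r)\<close>, the function \<open>G\<close> is linear on every
  line through the origin: \<open>G y = y\<close> and \<open>G (y (\<theta> + c)) = y (c ^ P + c + \<kappa>)\<close> for \<open>y, c \<in> K\<close>, where
  \<open>\<kappa> = \<theta> ^ P + \<theta> + 1\<close>. The inner sum over \<open>c\<close> in the Walsh transform of \<open>Tr (l G)\<close> is then a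
  character sum of a linearized polynomial and vanishes for all but at most one \<open>y = \<beta>\<close>, because
  \<open>gcd (k - r) k = 1\<close>. Hence the transform is \<open>\<plusminus>q\<close>, and translating its argument by \<open>u \<in> K\<close>
  multiplies it by the character value \<open>(-1) ^ Tr (\<beta> u)\<close>. Expanding the sign of
  \<open>Tr l * F (\<dots>)\<close> in characters of \<open>Tr (u_i x)\<close>, the Walsh transform of \<open>Tr (l H)\<close> is the one of
  \<open>Tr (l G)\<close> multiplied by a sign.

  For the degree, \<open>f\<close> has algebraic degree at most \<open>m\<close> iff all its iterated derivatives of order
  \<open>m\<close> are constant. The monomials of \<open>G\<close> are products \<open>A ^ i * B ^ (2 ^ r - i)\<close> with additive \<open>A\<close>, \<open>B\<close>
  and have degree at most \<open>r + 1 \<le> k\<close>, while \<open>F\<close> has degree exactly \<open>k\<close> since the linear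
  forms \<open>Tr (u_i x)\<close> are independent; so \<open>F\<close> cannot cancel against a coordinate of \<open>G\<close> of smaller
  degree.
\<close>

section \<open>Traces and characters\<close>

text \<open>Multiplication by \<open>x \<noteq> 0\<close> permutes the nonzero elements, so the
  factor \<open>x ^ card ?U\<close> leaves their product unchanged.\<close>

lemma finite_field_power_card:
  fixes x :: "'a::{field,finite}"
  shows "x ^ card (UNIV :: 'a set) = x"
proof (cases "x = 0")
  case True
  then show ?thesis
    by (simp add: power_0_left card_eq_0_iff)
next
  case False
  let ?U = "UNIV - {0::'a}"
  have "(\<Prod>y\<in>?U. x * y) = \<Prod>?U"
    using False by (intro prod.reindex_bij_witness[of _ "\<lambda>y. y / x" "(*) x"]) auto
  then have "x ^ card ?U * \<Prod>?U = \<Prod>?U"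
    by (simp add: prod.distrib)
  moreover have "\<Prod>?U \<noteq> 0"
    by simp
  ultimately have "x ^ card ?U = 1"
    by simp
  moreover have "card (UNIV :: 'a set) = Suc (card ?U)"
    using card.remove[of UNIV "0::'a"] by simp
  ultimately show ?thesis
    by (simp only: power_Suc mult_1_right)
qed

lemma chi_add:
  fixes x y :: "'a::field"
  assumes "(2::'a) = 0" "x \<in> {0, 1}" "y \<in> {0, 1}"
  shows "chi (x + y) = chi x * chi y"
  using assms by (auto simp: chi_def)

lemma abs_chi: "\<bar>chi x\<bar> = 1"
  by (simp add: chi_def)

text \<open>The involution \<open>s\<close> flips every sign, so the sum equals its own
  negative.\<close>

lemma sum_chi_0:
  fixes f :: "'b \<Rightarrow> 'a::field"
  assumes two: "(2::'a) = 0" and z: "z \<in> A" "f z = 1"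
    and bit: "\<And>x. x \<in> A \<Longrightarrow> f x \<in> {0, 1}"
    and cl: "\<And>x. x \<in> A \<Longrightarrow> s x \<in> A" "\<And>x. x \<in> A \<Longrightarrow> s (s x) = x"
    and shift: "\<And>x. x \<in> A \<Longrightarrow> f (s x) = f x + f z"
  shows "(\<Sum>x\<in>A. chi (f x)) = 0"
proof -
  have "(\<Sum>x\<in>A. chi (f x)) = (\<Sum>x\<in>A. chi (f (s x)))"
    by (rule sum.reindex_bij_witness[of _ s s]) (use cl in auto)
  also have "\<dots> = (\<Sum>x\<in>A. - chi (f x))"
  proof (rule sum.cong)
    have "1 + 1 = (0::'a)"
      using two by simp
    moreover have "f (s x) = f x + 1" if "x \<in> A" for x
      using shift[OF that] z by simp
    ultimately show "chi (f (s x)) = - chi (f x)" if "x \<in> A" for x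
      using bit[OF that] that by (auto simp: chi_def)
  qed simp
  finally show ?thesis
    by (simp add: sum_negf)
qed

text \<open>The field has \<open>q ^ 2\<close> elements, so \<open>x \<mapsto> x ^ q\<close> is an
  involution; it acts like complex conjugation over its fixed field \<open>K\<close>.\<close>

locale quadratic_gf2 =
  fixes k :: nat and ty :: "'a::{field,finite} itself"
  assumes card_field: "card (UNIV :: 'a set) = 2 ^ (2 * k)"
    and k_pos: "0 < k"
begin

abbreviation K :: "'a set" where "K \<equiv> subfld k"
abbreviation q :: nat where "q \<equiv> 2 ^ k"
abbreviation conj :: "'a \<Rightarrow> 'a" where "conj x \<equiv> x ^ q"

text \<open>Translation by \<open>1\<close> permutes the field, hence adds nothing to the sum of all
  elements; the order, a power of two, is therefore zero in the field.\<close>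

lemma two_eq_0: "(2::'a) = 0"
proof -
  have "(\<Sum>x\<in>UNIV. x + 1) = (\<Sum>x\<in>UNIV. x::'a)"
    by (rule sum.reindex_bij_witness[of _ "\<lambda>x. x - 1" "\<lambda>x. x + 1"]) auto
  then have "of_nat (card (UNIV :: 'a set)) = (0::'a)"
    by (simp add: sum.distrib)
  then show ?thesis
    by (simp add: card_field)
qed

lemma add_self [simp]: "x + x = (0::'a)"
  using two_eq_0 by (metis mult_2 mult_zero_left)

lemma add_self_left [simp]: "x + (x + y) = (y::'a)"
  by (simp flip: add.assoc)

lemma uminus_eq [simp]: "- x = (x::'a)"
  by (rule minus_unique) simp

lemma diff_eq_add [simp]: "x - y = x + (y::'a)"
  using diff_conv_add_uminus[of x y] by simp

lemma add_eq_0_iff_eq: "x + y = 0 \<longleftrightarrow> x = (y::'a)"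
  by (auto simp: add_eq_0_iff)

lemma frob_add: "(x + y) ^ (2 ^ i) = x ^ (2 ^ i) + (y::'a) ^ (2 ^ i)"
proof (induction i)
  case (Suc i)
  have "(x + y) ^ (2 ^ Suc i) = ((x + y) ^ (2 ^ i))\<^sup>2"
    by (simp add: mult.commute flip: power_mult)
  also have "\<dots> = (x ^ (2 ^ i))\<^sup>2 + (y ^ (2 ^ i))\<^sup>2"
    by (simp add: Suc power2_sum two_eq_0)
  finally show ?case
    by (simp add: mult.commute flip: power_mult)
qed simp

lemma frob_inj: "x ^ (2 ^ i) = y ^ (2 ^ i) \<longleftrightarrow> x = (y::'a)"
proof
  assume "x ^ (2 ^ i) = y ^ (2 ^ i)"
  then have "(x + y) ^ (2 ^ i) = 0"
    by (simp add: frob_add)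
  then show "x = y"
    by (simp add: add_eq_0_iff_eq)
qed simp

lemma conj_conj [simp]: "conj (conj x) = x"
proof -
  have "conj (conj x) = x ^ (2 ^ (2 * k))"
    by (simp add: mult_2 power_add flip: power_mult)
  then show ?thesis
    using finite_field_power_card[of x] by (simp only: card_field)
qed

lemma K_iff: "x \<in> K \<longleftrightarrow> conj x = x"
  by (simp add: subfld_def)

lemma K_power [simp, intro]: "x \<in> K \<Longrightarrow> x ^ m \<in> K"
  by (induction m) (simp_all add: K_iff power_mult_distrib)

lemma K_closed [simp, intro]:
  "0 \<in> K" "1 \<in> K"
  "x \<in> K \<Longrightarrow> y \<in> K \<Longrightarrow> x + y \<in> K"
  "x \<in> K \<Longrightarrow> y \<in> K \<Longrightarrow> x * y \<in> K"
  "x \<in> K \<Longrightarrow> y \<in> K \<Longrightarrow> x / y \<in> K"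
  by (simp_all add: K_iff frob_add power_mult_distrib power_divide)

lemma bit_in_K: "x \<in> {0, 1} \<Longrightarrow> x \<in> K"
  by auto

lemma K_sum: "(\<And>i. i \<in> A \<Longrightarrow> f i \<in> K) \<Longrightarrow> sum f A \<in> K"
  by (induction A rule: infinite_finite_induct) auto

lemma add_conj_in_K [simp, intro]: "x + conj x \<in> K"
  by (simp only: K_iff frob_add conj_conj) (rule add.commute)

section \<open>The traces of \<open>K\<close> and of the whole field\<close>

lemma tr_add: "tr m (x + y) = tr m x + tr m (y::'a)"
  by (simp add: tr_def frob_add sum.distrib)

lemma tr_zero [simp]: "tr m (0::'a) = 0"
  by (simp add: tr_def power_0_left)

lemma tr_sum: "tr m (sum f A) = (\<Sum>i\<in>A. tr m (f i :: 'a))"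
  by (induction A rule: infinite_finite_induct) (simp_all add: tr_add)

text \<open>Squaring shifts every term of the trace by one place, so all but the first and the last
  cancel.\<close>

lemma tr_square_add: "(tr m x)\<^sup>2 + tr m x = x ^ (2 ^ m) + (x::'a)"
proof (induction m)
  case (Suc m)
  have "tr (Suc m) x = tr m x + x ^ (2 ^ m)"
    by (simp add: tr_def)
  then have "(tr (Suc m) x)\<^sup>2 + tr (Suc m) x
      = ((tr m x)\<^sup>2 + tr m x) + ((x ^ (2 ^ m))\<^sup>2 + x ^ (2 ^ m))"
    by (simp add: power2_sum two_eq_0 add_ac)
  also have "\<dots> = (x ^ (2 ^ m) + x) + ((x ^ (2 ^ m))\<^sup>2 + x ^ (2 ^ m))"
    by (simp only: Suc)
  also have "\<dots> = (x ^ (2 ^ m))\<^sup>2 + x"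
    by (simp add: add_ac)
  also have "\<dots> = x ^ (2 ^ Suc m) + x"
    by (simp add: mult.commute flip: power_mult)
  finally show ?case .
qed (simp add: tr_def)

lemma tr_bit:
  assumes "x \<in> K"
  shows "tr k x \<in> {0, 1}"
proof -
  have "(tr k x)\<^sup>2 + tr k x = 0"
    using assms tr_square_add[of k x] by (simp add: K_iff)
  then have "tr k x * (tr k x + 1) = 0"
    by (simp add: power2_eq_square algebra_simps)
  then show ?thesis
    by (auto simp: add_eq_0_iff_eq)
qed

lemma tr_square:
  assumes "x \<in> K"
  shows "tr k (x\<^sup>2) = tr k x"
proof -
  have "tr k (x\<^sup>2) = (tr k x)\<^sup>2"
    unfolding tr_def
  proof (induction k)
    case (Suc m)
    then show ?case
      by (simp add: power2_sum two_eq_0 mult.commute flip: power_mult)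
  qed simp
  then show ?thesis
    using tr_bit[OF assms] by auto
qed

lemma tr_frob:
  assumes "x \<in> K"
  shows "tr k (x ^ (2 ^ i)) = tr k x"
proof (induction i)
  case (Suc i)
  have "x ^ (2 ^ Suc i) = (x ^ (2 ^ i))\<^sup>2"
    by (simp add: mult.commute flip: power_mult)
  then show ?case
    using Suc tr_square[of "x ^ (2 ^ i)"] assms by simp
qed simp

text \<open>Transitivity of the trace: the terms from index \<open>k\<close> on are the first
  \<open>k\<close> terms for \<open>conj x\<close>.\<close>

lemma tr_double: "tr (2 * k) x = tr k (x + conj x :: 'a)"
proof -
  have "tr (2 * k) x = (\<Sum>i<k. x ^ (2 ^ i)) + (\<Sum>i\<in>{k..<2*k}. x ^ (2 ^ i))"
    unfolding tr_def by (subst sum.union_disjoint[symmetric]) (auto intro: sum.cong)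
  also have "(\<Sum>i\<in>{k..<2*k}. x ^ (2 ^ i)) = (\<Sum>i<k. x ^ (2 ^ (k + i)))"
    by (rule sum.reindex_bij_witness[of _ "\<lambda>i. k + i" "\<lambda>i. i - k"]) auto
  also have "\<dots> = (\<Sum>i<k. conj x ^ (2 ^ i))"
    by (simp add: power_add power_mult)
  finally show ?thesis
    by (simp add: tr_def frob_add sum.distrib)
qed

lemma tr_double_bit: "tr (2 * k) (x::'a) \<in> {0, 1}"
  unfolding tr_double by (rule tr_bit) auto

lemma card_frob_fixed_le: "card {x::'a. x ^ (2 ^ k) = x} \<le> q"
proof -
  let ?p = "monom 1 q - monom 1 1 :: 'a poly"
  have "coeff ?p q = 1"
    using k_pos by (cases k) (simp_all add: coeff_monom)
  then have nz: "?p \<noteq> 0"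
    by (metis coeff_0 zero_neq_one)
  have "card {x::'a. x ^ (2 ^ k) = x} = card {x. poly ?p x = 0}"
    by (simp add: poly_monom add_eq_0_iff_eq del: diff_eq_add)
  also have "\<dots> \<le> degree ?p"
    using nz by (rule card_poly_roots_bound)
  also have "\<dots> \<le> q"
    by (intro degree_diff_le) (auto intro: order.trans[OF degree_monom_le])
  finally show ?thesis .
qed

text \<open>\<open>K\<close> is too small to be the whole field; for \<open>x\<close> outside it,
  \<open>x + conj x\<close> is a nonzero element of \<open>K\<close> and can be scaled to
  \<open>1\<close>.\<close>

lemma ex_theta: "\<exists>\<theta>::'a. \<theta> + conj \<theta> = 1"
proof -
  have "card K \<le> q"
    using card_frob_fixed_le by (simp add: subfld_def)
  also have "q < card (UNIV :: 'a set)"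
    using k_pos unfolding card_field by (intro power_strict_increasing) auto
  finally have "K \<noteq> UNIV"
    by auto
  then obtain x :: 'a where x: "x \<notin> K"
    by auto
  define s where "s = x + conj x"
  have s: "s \<in> K" "s \<noteq> 0"
    using x add_conj_in_K[of x] by (auto simp: s_def add_eq_0_iff_eq) (metis K_iff)
  have "x / s + conj (x / s) = 1"
    using s unfolding K_iff by (simp only: power_divide flip: add_divide_distrib) (simp add: s_def)
  then show ?thesis ..
qed

text \<open>Otherwise the trace of the whole field, which factors through \<open>K\<close>, would
  vanish everywhere, although it is a nonzero polynomial of degree below the order of the
  field.\<close>

lemma ex_tr_1: "\<exists>x\<in>K. tr k x = 1"
proof (rule ccontr)
  assume neg: "\<not> ?thesis"
  have z: "tr k x = 0" if "x \<in> K" for x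
    using tr_bit[OF that] neg that by auto
  have all: "tr (2 * k) x = 0" for x :: 'a
    unfolding tr_double by (intro z) auto
  define p where "p = (\<Sum>i<2*k. monom 1 (2 ^ i) :: 'a poly)"
  have "coeff p (2 ^ 0) = (\<Sum>i<2*k. if i = 0 then 1 else 0)"
    unfolding p_def coeff_sum by (intro sum.cong) (auto simp: coeff_monom)
  also have "\<dots> = 1"
    using k_pos by simp
  finally have nz: "p \<noteq> 0"
    by (metis coeff_0 zero_neq_one)
  have "poly p x = 0" for x
    using all[of x] by (simp add: p_def tr_def poly_sum poly_monom)
  then have "card (UNIV :: 'a set) \<le> degree p"
    using card_poly_roots_bound[OF nz] by simp
  also have "degree p \<le> 2 ^ (2 * k - 1)"
    unfolding p_def by (intro degree_sum_le) (auto intro!: order.trans[OF degree_monom_le])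
  also have "\<dots> < 2 ^ (2 * k)"
    using k_pos by (intro power_strict_increasing) auto
  finally show False
    by (simp add: card_field)
qed

lemma tr_nondegenerate:
  assumes "b \<in> K" "b \<noteq> 0"
  obtains z where "z \<in> K" "tr k (z * b) = 1"
proof -
  obtain x where "x \<in> K" "tr k x = 1"
    using ex_tr_1 by auto
  then show ?thesis
    using assms by (intro that[of "x / b"]) auto
qed

text \<open>Orthogonality of characters: for \<open>b \<noteq> 0\<close>, a shift by some
  \<open>z\<close> with \<open>tr k (z * b) = 1\<close> reverses every sign.\<close>

lemma sum_chi_tr:
  assumes b: "b \<in> K"
  shows "(\<Sum>y\<in>K. chi (tr k (y * b))) = (if b = 0 then real (card K) else 0)"
proof (cases "b = 0")
  case True
  then show ?thesis
    by (simp add: chi_def)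
next
  case False
  then obtain z where z: "z \<in> K" "tr k (z * b) = 1"
    using b tr_nondegenerate by blast
  have "(\<Sum>y\<in>K. chi (tr k (y * b))) = 0"
  proof (rule sum_chi_0[of z K _ "\<lambda>y. y + z"])
    show "tr k (x * b) \<in> {0, 1}" if "x \<in> K" for x
      using that b by (intro tr_bit) auto
  qed (use z two_eq_0 in \<open>auto simp: distrib_right tr_add add.assoc\<close>)
  then show ?thesis
    using False by simp
qed

end

section \<open>The Walsh transform of the Niho sum\<close>

text \<open>Every exponent is \<open>1\<close> modulo \<open>2 ^ k - 1\<close> (a Niho exponent),
  which makes each monomial the identity on \<open>subfld k\<close>.\<close>

definition niho_sum :: "nat \<Rightarrow> nat \<Rightarrow> 'a::field \<Rightarrow> 'a" where
  "niho_sum k r x = (\<Sum>i\<in>{1..2 ^ r - 1}. x ^ ((i * 2 ^ (k - r) + 1) * (2 ^ k - 1) + 1))"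

context quadratic_gf2
begin

section \<open>Decomposing the field into lines over \<open>K\<close>\<close>

lemma conj_theta: "\<theta> + conj \<theta> = 1 \<Longrightarrow> conj \<theta> = 1 + \<theta>"
  by (metis add.commute add_self_left)

text \<open>\<open>\<theta>\<close> and \<open>1\<close> form a basis over \<open>K\<close>, and
  because \<open>\<theta> + conj \<theta> = 1\<close> the coefficient of \<open>\<theta>\<close> in
  \<open>x\<close> is \<open>x + conj x\<close>.\<close>

lemma sum_over_K_plane:
  assumes \<theta>: "\<theta> + conj \<theta> = 1"
  shows "(\<Sum>x\<in>UNIV. h x) = (\<Sum>y\<in>K. \<Sum>b\<in>K. h (y * \<theta> + b))"
proof -
  have conj_\<theta>: "conj \<theta> = 1 + \<theta>"
    using \<theta> by (rule conj_theta)
  have "(\<Sum>x\<in>UNIV. h x) = (\<Sum>(y, b)\<in>K \<times> K. h (y * \<theta> + b))"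
  proof (rule sum.reindex_bij_witness[of _ "\<lambda>(y, b). y * \<theta> + b" "\<lambda>x. (x + conj x, x + (x + conj x) * \<theta>)"],
      goal_cases)
    case (2 x)
    have "conj (x + (x + conj x) * \<theta>) = conj x + conj (x + conj x) * conj \<theta>"
      by (simp only: frob_add power_mult_distrib)
    also have "\<dots> = x + (x + conj x) * \<theta>"
      by (simp only: frob_add conj_conj conj_\<theta>) (simp add: algebra_simps)
    finally show ?case
      using add_conj_in_K by (auto simp: K_iff)
  next
    case (3 yb)
    then show ?case
      by (auto simp: K_iff frob_add power_mult_distrib conj_\<theta> algebra_simps)
  qed (auto simp: algebra_simps)
  then show ?thesis
    by (simp add: sum.cartesian_product)
qed

lemma card_K: "card K = q"
proof -
  obtain \<theta> :: 'a where \<theta>: "\<theta> + conj \<theta> = 1"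
    using ex_theta by blast
  have "card (UNIV :: 'a set) = card K * card K"
    using sum_over_K_plane[OF \<theta>, of "\<lambda>_. 1::nat"] by simp
  then have "card K ^ 2 = q ^ 2"
    by (simp add: card_field power2_eq_square mult_2 power_add)
  then show ?thesis
    by simp
qed

text \<open>Substituting \<open>b = y * c\<close> sorts the points outside \<open>K\<close> by their
  direction \<open>\<theta> + c\<close>, that is, by the lines through the origin on which
  \<open>G\<close> is linear.\<close>

lemma sum_over_spread:
  assumes \<theta>: "\<theta> + conj \<theta> = 1"
  shows "(\<Sum>x\<in>UNIV. h x) = (\<Sum>b\<in>K. h b) + (\<Sum>y\<in>K - {0}. \<Sum>c\<in>K. h (y * (\<theta> + c)))"
proof -
  have "(\<Sum>b\<in>K. h (y * \<theta> + b)) = (\<Sum>c\<in>K. h (y * (\<theta> + c)))" if "y \<in> K - {0}" for y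
    by (rule sum.reindex_bij_witness[of _ "\<lambda>c. y * c" "\<lambda>b. b / y"])
      (use that in \<open>auto simp: algebra_simps\<close>)
  moreover have "(\<Sum>y\<in>K. \<Sum>b\<in>K. h (y * \<theta> + b))
      = (\<Sum>b\<in>K. h b) + (\<Sum>y\<in>K - {0}. \<Sum>b\<in>K. h (y * \<theta> + b))"
    by (subst sum.remove[of K 0]) auto
  ultimately show ?thesis
    by (simp add: sum_over_K_plane[OF \<theta>])
qed

lemma frob_bij_K: "bij_betw (\<lambda>c. c ^ (2 ^ j)) K K"
proof -
  have "inj_on (\<lambda>c. c ^ (2 ^ j)) K"
    by (simp add: inj_on_def frob_inj)
  moreover from this have "(\<lambda>c. c ^ (2 ^ j)) ` K = K"
    by (intro endo_inj_surj) auto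
  ultimately show ?thesis
    by (simp add: bij_betw_def)
qed

text \<open>Frobenius invariance of the trace replaces \<open>y * m * c\<close> by its
  \<open>2 ^ j\<close>-th power, so \<open>c\<close> enters only through \<open>c ^ (2 ^ j)\<close>.
  This power runs through \<open>K\<close>, and orthogonality applies to its coefficient
  \<open>w\<close>.\<close>

lemma sum_chi_linearized:
  assumes K: "l \<in> K" "m \<in> K" "t \<in> K" "y \<in> K"
  shows "(\<Sum>c\<in>K. chi (tr k (y * (l * c ^ (2 ^ j) + m * c + t))))
    = (if y * l = (y * m) ^ (2 ^ j) then real q * chi (tr k (y * t)) else 0)"
proof -
  define w where "w = y * l + (y * m) ^ (2 ^ j)"
  have w: "w \<in> K"
    using K by (auto simp: w_def)
  have "chi (tr k (y * (l * c ^ (2 ^ j) + m * c + t)))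
      = chi (tr k (c ^ (2 ^ j) * w)) * chi (tr k (y * t))" if c: "c \<in> K" for c
  proof -
    have "tr k (y * m * c) = tr k ((y * m * c) ^ (2 ^ j))"
      using K c by (intro tr_frob[symmetric]) auto
    then have "tr k (y * (l * c ^ (2 ^ j) + m * c + t)) = tr k (c ^ (2 ^ j) * w) + tr k (y * t)"
      by (simp add: w_def algebra_simps tr_add power_mult_distrib)
    moreover have "tr k (c ^ (2 ^ j) * w) \<in> {0, 1}" "tr k (y * t) \<in> {0, 1}"
      using K c w by (auto intro!: tr_bit simp del: insert_iff)
    ultimately show ?thesis
      by (simp only: chi_add[OF two_eq_0])
  qed
  then have "(\<Sum>c\<in>K. chi (tr k (y * (l * c ^ (2 ^ j) + m * c + t))))
      = (\<Sum>c\<in>K. chi (tr k (c ^ (2 ^ j) * w))) * chi (tr k (y * t))"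
    by (simp add: sum_distrib_right)
  also have "(\<Sum>c\<in>K. chi (tr k (c ^ (2 ^ j) * w))) = (\<Sum>c\<in>K. chi (tr k (c * w)))"
    by (rule sum.reindex_bij_betw[OF frob_bij_K])
  also have "\<dots> = (if w = 0 then real q else 0)"
    by (simp add: sum_chi_tr[OF w] card_K)
  also have "w = 0 \<longleftrightarrow> y * l = (y * m) ^ (2 ^ j)"
    by (simp add: w_def add_eq_0_iff_eq)
  finally show ?thesis
    by simp
qed

text \<open>By Bezout, an element fixed by the \<open>j\<close>-th and the \<open>k\<close>-th
  iterate of squaring is fixed by squaring itself.\<close>

lemma frob_fixed:
  assumes "e \<in> K" "e ^ (2 ^ j) = e" "gcd j k = 1" "0 < j"
  shows "e \<in> {0, 1}"
proof -
  have iter: "e ^ (2 ^ (i * m)) = e" if "e ^ (2 ^ i) = e" for i m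
    using that by (induction m) (simp_all add: power_add power_mult)
  obtain x y where "j * x = k * y + 1"
    using bezout_nat[of j k] assms by auto
  then have "e = e ^ (2 ^ (k * y + 1))"
    using iter[of j x] assms by simp
  also have "\<dots> = (e ^ (2 ^ (k * y)))\<^sup>2"
    by (simp add: power_add mult.commute flip: power_mult)
  also have "\<dots> = e * e"
    using iter[of k y] assms by (simp add: K_iff power2_eq_square)
  finally show ?thesis
    by auto
qed

text \<open>Division by \<open>y\<close> turns the equation into
  \<open>y ^ (2 ^ j - 1) = l / m ^ (2 ^ j)\<close>. This power map, written as the quotient
  \<open>?f\<close>, is injective: the quotient of two elements with equal image is a nonzero
  element fixed by Frobenius, hence \<open>1\<close>. Finiteness makes it onto.\<close>

lemma ex1_linearized:
  assumes l: "l \<in> K - {0}" and m: "m \<in> K - {0}" and j: "gcd j k = 1" "0 < j"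
  shows "\<exists>!y. y \<in> K - {0} \<and> y * l = (y * m) ^ (2 ^ j)"
proof -
  let ?f = "\<lambda>y::'a. y ^ (2 ^ j) / y"
  have inj: "inj_on ?f (K - {0})"
  proof (rule inj_onI)
    fix y z assume yz: "y \<in> K - {0}" "z \<in> K - {0}" "?f y = ?f z"
    then have nz: "y \<noteq> 0" "z \<noteq> 0"
      by auto
    have "(y / z) ^ (2 ^ j) = y / z"
      using yz(3) nz by (simp only: power_divide frac_eq_eq power_not_zero not_False_eq_True mult.commute)
    moreover have "y / z \<in> K"
      using yz by (intro K_closed) auto
    ultimately have "y / z \<in> {0, 1}"
      using j by (intro frob_fixed[of _ j])
    then show "y = z"
      using nz by simp
  qed
  have "?f ` (K - {0}) \<subseteq> K - {0}"
    by auto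
  then have surj: "?f ` (K - {0}) = K - {0}"
    using inj by (intro endo_inj_surj) simp_all
  have eq: "y * l = (y * m) ^ (2 ^ j) \<longleftrightarrow> ?f y = l / m ^ (2 ^ j)" if "y \<in> K - {0}" for y
  proof -
    have nz: "y \<noteq> 0" "m ^ (2 ^ j) \<noteq> 0"
      using that m by auto
    show ?thesis
      by (simp only: frac_eq_eq[OF nz] power_mult_distrib mult.commute[of y l])
        (rule eq_commute)
  qed
  have "l / m ^ (2 ^ j) \<in> K - {0}"
    using l m by auto
  then have "l / m ^ (2 ^ j) \<in> ?f ` (K - {0})"
    by (simp only: surj)
  then obtain y where y: "l / m ^ (2 ^ j) = ?f y" "y \<in> K - {0}"
    by (rule imageE)
  show ?thesis
  proof (rule ex1I[of _ y])
    fix z assume z: "z \<in> K - {0} \<and> z * l = (z * m) ^ (2 ^ j)"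
    then have "?f z = l / m ^ (2 ^ j)"
      by (intro iffD1[OF eq]) blast+
    then have "?f z = ?f y"
      using y(1) by (rule trans)
    then show "z = y"
      by (rule inj_onD[OF inj]) (use z y(2) in blast)+
  next
    show "y \<in> K - {0} \<and> y * l = (y * m) ^ (2 ^ j)"
      using y(2) iffD2[OF eq[OF y(2)] y(1)[symmetric]] by (rule conjI)
  qed
qed

end

locale niho = quadratic_gf2 k ty for k and ty :: "'a::{field,finite} itself" +
  fixes r :: nat
  assumes r: "0 < r" "r < k" "gcd r k = 1"
begin

abbreviation P :: nat where "P \<equiv> 2 ^ (k - r)"
abbreviation Q :: nat where "Q \<equiv> 2 ^ r"
abbreviation G :: "'a \<Rightarrow> 'a" where "G \<equiv> niho_sum k r"

lemma P_times_Q: "P * Q = q"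
  using r by (simp flip: power_add)

lemma power_P_Q: "(x ^ P) ^ Q = conj x"
  by (simp only: P_times_Q flip: power_mult)

text \<open>Since \<open>P * Q = q\<close>, the exponent equals
  \<open>q * (P * i) + P * (Q - i)\<close>.\<close>

lemma niho_sum_geometric: "G x = (\<Sum>i\<in>{1..Q - 1}. (conj x ^ P) ^ i * (x ^ P) ^ (Q - i))"
  unfolding niho_sum_def
proof (rule sum.cong)
  fix i assume "i \<in> {1..Q - 1}"
  then have "i \<le> Q"
    by auto
  then have "P * (Q - i) + P * i = q"
    by (simp add: P_times_Q flip: distrib_left)
  moreover have "(i * P + 1) * (q - 1) + (i * P + 1) = (i * P + 1) * q"
    by (metis Suc_diff_1 mult_Suc_right add.commute zero_less_numeral zero_less_power)
  ultimately have "(i * P + 1) * (q - 1) + 1 = q * (P * i) + P * (Q - i)"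
    by (simp add: algebra_simps)
  then show "x ^ ((i * P + 1) * (q - 1) + 1) = (conj x ^ P) ^ i * (x ^ P) ^ (Q - i)"
    by (simp only: power_add power_mult)
qed simp

text \<open>The number of summands, \<open>2 ^ r - 1\<close>, is odd, and each equals
  \<open>y\<close>.\<close>

lemma niho_sum_K:
  assumes "y \<in> K"
  shows "G y = y"
proof -
  have "(y ^ P) ^ i * (y ^ P) ^ (Q - i) = y" if "i \<in> {1..Q - 1}" for i
  proof -
    have "i + (Q - i) = Q"
      using that by auto
    then have "(y ^ P) ^ i * (y ^ P) ^ (Q - i) = (y ^ P) ^ Q"
      by (simp only: flip: power_add)
    then show ?thesis
      using assms by (simp only: power_P_Q K_iff)
  qed
  then have "G y = of_nat (Q - 1) * y"
    using assms by (simp add: niho_sum_geometric K_iff)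
  moreover have "of_nat (Q - 1) = (1::'a)"
    using r by (simp add: of_nat_diff two_eq_0 power_0_left)
  ultimately show ?thesis
    by simp
qed

text \<open>Multiplied by the sum of its two bases, the geometric progression telescopes; the
  \<open>Q\<close>-th powers of the bases, which occur in the end terms, are \<open>x\<close> and
  \<open>conj x\<close>.\<close>

lemma niho_sum_times: "(x + conj x) ^ P * G x = x ^ P * x + conj x ^ P * conj x"
proof -
  let ?A = "conj x ^ P" and ?B = "x ^ P"
  \<comment> \<open>The total degree \<open>Suc Q\<close> is one more than that of the summands: a
    factor \<open>?A\<close> raises the index of \<open>?h\<close>, a factor \<open>?B\<close> keeps
    it.\<close>
  let ?h = "\<lambda>i. ?A ^ i * ?B ^ (Suc Q - i)"
  have "(x + conj x) ^ P * G x = (?A + ?B) * (\<Sum>i\<in>{1..Q - 1}. ?A ^ i * ?B ^ (Q - i))"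
    by (simp add: niho_sum_geometric frob_add add.commute)
  also have "\<dots> = (\<Sum>i\<in>{1..Q - 1}. ?h (Suc i) - ?h i)"
    unfolding sum_distrib_left
  proof (rule sum.cong)
    fix i assume "i \<in> {1..Q - 1}"
    then have "Suc Q - i = Suc (Q - i)"
      by auto
    then show "(?A + ?B) * (?A ^ i * ?B ^ (Q - i)) = ?h (Suc i) - ?h i"
      by (simp add: algebra_simps)
  qed simp
  also have "\<dots> = ?h Q - ?h 1"
    using sum_Suc_diff[of 1 "Q - 1" ?h] by simp
  also have "?h 1 = ?A * conj x"
    by (simp add: power_P_Q)
  also have "?h Q = x * ?B"
    by (simp only: power_P_Q conj_conj) simp
  finally show ?thesis
    by (simp add: mult.commute)
qed

text \<open>Here \<open>x + conj x = y\<close>, so the telescoped identity can be divided by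
  \<open>y ^ P\<close>. With \<open>z = \<theta> + c\<close>, the products \<open>z ^ P * z\<close>
  and \<open>(z + 1) ^ P * (z + 1)\<close> add up to \<open>z ^ P + z + 1\<close>.\<close>

lemma niho_sum_line:
  assumes \<theta>: "\<theta> + conj \<theta> = 1" and y: "y \<in> K - {0}" and c: "c \<in> K"
  shows "G (y * (\<theta> + c)) = y * (c ^ P + c + (\<theta> ^ P + \<theta> + 1))"
proof -
  have conj_\<theta>: "conj \<theta> = 1 + \<theta>"
    using \<theta> by (rule conj_theta)
  let ?x = "y * (\<theta> + c)"
  have cx: "conj ?x = y * (\<theta> + c + 1)"
    using y c by (simp add: power_mult_distrib frob_add conj_\<theta> K_iff add_ac)
  have "?x + conj ?x = y"
    unfolding cx by (simp add: algebra_simps)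
  then have "y ^ P * G ?x = ?x ^ P * ?x + conj ?x ^ P * conj ?x"
    using niho_sum_times[of ?x] by simp
  also have "\<dots> = y ^ P * (y * (c ^ P + c + (\<theta> ^ P + \<theta> + 1)))"
    unfolding cx by (simp add: power_mult_distrib frob_add algebra_simps)
  finally show ?thesis
    using y by simp
qed

text \<open>This is the constant term of the linearized polynomial met in the Walsh transform.
  Conjugation adds \<open>1\<close> to both \<open>\<theta> ^ P\<close> and \<open>\<theta>\<close>,
  hence fixes their sum.\<close>

lemma phase_in_K:
  assumes \<theta>: "\<theta> + conj \<theta> = 1" and l: "l \<in> K"
  shows "l * (\<theta> ^ P + \<theta> + 1) + (a + conj a) * \<theta> + conj a \<in> K"
proof -
  have conj_P: "conj (\<theta> ^ P) = 1 + \<theta> ^ P"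
    by (simp only: mult.commute flip: power_mult) (simp add: power_mult conj_theta[OF \<theta>] frob_add)
  have 1: "conj (\<theta> ^ P + \<theta> + 1) = \<theta> ^ P + \<theta> + 1"
    by (simp only: frob_add conj_P conj_theta[OF \<theta>]) (simp add: add_ac)
  have 2: "conj ((a + conj a) * \<theta> + conj a) = (a + conj a) * \<theta> + conj a"
    by (simp only: frob_add power_mult_distrib conj_conj conj_theta[OF \<theta>])
      (simp add: algebra_simps)
  show ?thesis
    unfolding add.assoc[of "l * _"]
    using K_closed(3)[OF K_closed(4)[OF l]] 1 2 unfolding K_iff by blast
qed

text \<open>Conjugation exchanges the two bases and thereby reverses the order of the
  summands.\<close>

lemma niho_sum_in_K: "G x \<in> K"
proof -
  have "conj (G x) = (\<Sum>i\<in>{1..Q - 1}. (x ^ P) ^ i * (conj x ^ P) ^ (Q - i))"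
  proof -
    have *: "conj (sum f A) = (\<Sum>i\<in>A. conj (f i))" for f :: "nat \<Rightarrow> 'a" and A
      by (induction A rule: infinite_finite_induct) (simp_all add: frob_add power_0_left)
    have "conj ((conj x ^ P) ^ i * (x ^ P) ^ j) = (conj (conj x) ^ P) ^ i * (conj x ^ P) ^ j" for i j
      by (simp only: power_mult_distrib flip: power_mult) (simp only: ac_simps)
    then show ?thesis
      by (simp only: niho_sum_geometric * conj_conj)
  qed
  also have "\<dots> = G x"
    unfolding niho_sum_geometric
    by (rule sum.reindex_bij_witness[of _ "\<lambda>i. Q - i" "\<lambda>i. Q - i"]) auto
  finally show ?thesis
    by (simp add: K_iff)
qed

text \<open>What matters later is that \<open>\<beta>\<close> depends on \<open>a\<close> only through \<open>s\<close>, hence does not change when \<open>a\<close>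
  is translated by an element of \<open>K\<close>.\<close>
lemma walsh_niho_sum:
  assumes \<theta>: "\<theta> + conj \<theta> = 1" and l: "l \<in> K - {0}" and s: "s \<in> K"
  obtains \<beta> where "\<beta> \<in> K"
    "\<And>a. a + conj a = s \<Longrightarrow> (\<Sum>x\<in>UNIV. chi (tr k (l * G x) + tr (2 * k) (a * x)))
      = real q * chi (tr k (\<beta> * (l * (\<theta> ^ P + \<theta> + 1) + s * \<theta> + conj a)))"
proof -
  \<comment> \<open>\<open>m\<close> is the coefficient of \<open>c\<close> off \<open>K\<close> and
    of \<open>b\<close> on \<open>K\<close>: \<open>l\<close> comes from \<open>G\<close>,
    \<open>s\<close> from the linear character.\<close>
  define m where "m = l + s"
  have m: "m \<in> K"
    using l s by (auto simp: m_def)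
  let ?R = "\<lambda>y. y * l = (y * m) ^ P"
  have conj_\<theta>: "conj \<theta> = 1 + \<theta>"
    using \<theta> by (rule conj_theta)
  \<comment> \<open>The line \<open>K\<close> contributes exactly when \<open>m = 0\<close>; off
    \<open>K\<close>, the sum over \<open>c\<close> survives only for those \<open>y\<close> with
    \<open>?R y\<close>.\<close>
  have walsh: "(\<Sum>x\<in>UNIV. chi (tr k (l * G x) + tr (2 * k) (a * x)))
      = real q * (if m = 0 then 1 else 0)
        + real q * (\<Sum>y | y \<in> K - {0} \<and> ?R y. chi (tr k (y * t)))"
    if a: "a + conj a = s" and t: "t = l * (\<theta> ^ P + \<theta> + 1) + s * \<theta> + conj a" for a t
  proof -
    have ca: "conj a = s + a"
      using a by (metis add.commute add_self_left)
    have t_K: "t \<in> K"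
      using l phase_in_K[OF \<theta>, of l a] by (simp add: t a)
    have 1: "(\<Sum>b\<in>K. chi (tr k (l * G b) + tr (2 * k) (a * b))) = (\<Sum>b\<in>K. chi (tr k (b * m)))"
    proof (rule sum.cong)
      fix b assume b: "b \<in> K"
      have "tr (2 * k) (a * b) = tr k (b * s)"
        unfolding tr_double using b by (simp add: K_iff power_mult_distrib ca algebra_simps)
      then show "chi (tr k (l * G b) + tr (2 * k) (a * b)) = chi (tr k (b * m))"
        using b by (simp add: niho_sum_K m_def algebra_simps tr_add)
    qed simp
    have 2: "(\<Sum>c\<in>K. chi (tr k (l * G (y * (\<theta> + c))) + tr (2 * k) (a * (y * (\<theta> + c)))))
        = (\<Sum>c\<in>K. chi (tr k (y * (l * c ^ P + m * c + t))))" if y: "y \<in> K - {0}" for y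
    proof (rule sum.cong)
      fix c assume c: "c \<in> K"
      have "conj (a * (y * (\<theta> + c))) = conj a * (y * (1 + \<theta> + c))"
        using y c by (simp add: K_iff power_mult_distrib frob_add conj_\<theta>)
      then have "tr (2 * k) (a * (y * (\<theta> + c))) = tr k (y * (s * c + s * \<theta> + conj a))"
        unfolding tr_double by (simp add: ca algebra_simps)
      then show "chi (tr k (l * G (y * (\<theta> + c))) + tr (2 * k) (a * (y * (\<theta> + c))))
          = chi (tr k (y * (l * c ^ P + m * c + t)))"
        unfolding niho_sum_line[OF \<theta> y c]
        by (simp add: m_def t algebra_simps flip: tr_add)
    qed simp
    have "(\<Sum>x\<in>UNIV. chi (tr k (l * G x) + tr (2 * k) (a * x)))
        = (\<Sum>b\<in>K. chi (tr k (b * m)))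
          + (\<Sum>y\<in>K - {0}. \<Sum>c\<in>K. chi (tr k (y * (l * c ^ P + m * c + t))))"
      unfolding sum_over_spread[OF \<theta>] 1 using 2 by simp
    also have "(\<Sum>b\<in>K. chi (tr k (b * m))) = real q * (if m = 0 then 1 else 0)"
      using m by (simp add: sum_chi_tr card_K)
    also have "(\<Sum>y\<in>K - {0}. \<Sum>c\<in>K. chi (tr k (y * (l * c ^ P + m * c + t))))
        = (\<Sum>y\<in>K - {0}. if ?R y then real q * chi (tr k (y * t)) else 0)"
      using l m t_K by (intro sum.cong sum_chi_linearized) auto
    also have "\<dots> = real q * (\<Sum>y | y \<in> K - {0} \<and> ?R y. chi (tr k (y * t)))"
      by (simp add: sum.inter_filter[symmetric] sum_distrib_left)
    finally show ?thesis .
  qed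
  show ?thesis
  \<comment> \<open>If \<open>m = 0\<close>, only the line \<open>K\<close> contributes and
    \<open>0\<close> serves as \<open>\<beta>\<close>; otherwise \<open>\<beta>\<close> is the
    unique solution of \<open>?R\<close>.\<close>
  proof (cases "m = 0")
    case True
    then have none: "{y. y \<in> K - {0} \<and> ?R y} = {}"
      using l by (auto simp: power_0_left)
    show ?thesis
    proof (rule that[of 0])
      fix a assume a: "a + conj a = s"
      show "(\<Sum>x\<in>UNIV. chi (tr k (l * G x) + tr (2 * k) (a * x)))
          = real q * chi (tr k (0 * (l * (\<theta> ^ P + \<theta> + 1) + s * \<theta> + conj a)))"
        unfolding walsh[OF a refl] none using True by (simp add: chi_def)
    qed simp
  next
    case False
    have "gcd (k - r) (k - r + r) = gcd (k - r) r"
      by simp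
    also have "\<dots> = gcd k r"
      using r by (intro gcd_diff1_nat) simp
    finally have "gcd (k - r) k = 1"
      using r by (simp add: gcd.commute)
    then have "\<exists>!y. y \<in> K - {0} \<and> ?R y"
      using l m False r by (intro ex1_linearized) simp_all
    then obtain \<beta> where \<beta>: "\<beta> \<in> K - {0}" and one: "{y. y \<in> K - {0} \<and> ?R y} = {\<beta>}"
      by (elim ex1E) blast
    show ?thesis
    proof (rule that[of \<beta>])
      fix a assume a: "a + conj a = s"
      show "(\<Sum>x\<in>UNIV. chi (tr k (l * G x) + tr (2 * k) (a * x)))
          = real q * chi (tr k (\<beta> * (l * (\<theta> ^ P + \<theta> + 1) + s * \<theta> + conj a)))"
        unfolding walsh[OF a refl] one using False by simp
    qed (use \<beta> in simp)
  qed
qed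

text \<open>Adding \<open>u \<in> K\<close> to \<open>a\<close> keeps \<open>a + conj a\<close>,
  hence \<open>\<beta>\<close>, while \<open>conj a\<close> changes by \<open>u\<close>; so the
  phase changes by \<open>\<beta> * u\<close> only.\<close>

lemma walsh_niho_sum_translate:
  assumes l: "l \<in> K - {0}"
  obtains \<beta> W where "\<beta> \<in> K" "\<bar>W\<bar> = real q"
    "\<And>u. u \<in> K \<Longrightarrow> (\<Sum>x\<in>UNIV. chi (tr k (l * G x) + tr (2 * k) ((a + u) * x)))
      = W * chi (tr k (\<beta> * u))"
proof -
  obtain \<theta> :: 'a where \<theta>: "\<theta> + conj \<theta> = 1"
    using ex_theta by blast
  define s where "s = a + conj a"
  have s: "s \<in> K"
    by (simp add: s_def)
  obtain \<beta> where \<beta>: "\<beta> \<in> K" and walsh: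
    "\<And>a. a + conj a = s \<Longrightarrow> (\<Sum>x\<in>UNIV. chi (tr k (l * G x) + tr (2 * k) (a * x)))
      = real q * chi (tr k (\<beta> * (l * (\<theta> ^ P + \<theta> + 1) + s * \<theta> + conj a)))"
    using walsh_niho_sum[OF \<theta> l s] by blast
  define t where "t = l * (\<theta> ^ P + \<theta> + 1) + s * \<theta> + conj a"
  have t_K: "t \<in> K"
    using l phase_in_K[OF \<theta>, of l a] by (simp add: t_def s_def)
  show ?thesis
  proof (rule that[of \<beta> "real q * chi (tr k (\<beta> * t))"])
    fix u assume u: "u \<in> K"
    have "(\<Sum>x\<in>UNIV. chi (tr k (l * G x) + tr (2 * k) ((a + u) * x)))
        = real q * chi (tr k (\<beta> * t) + tr k (\<beta> * u))"
      using u by (subst walsh) (simp_all add: s_def frob_add K_iff t_def algebra_simps flip: tr_add)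
    also have "\<dots> = real q * chi (tr k (\<beta> * t)) * chi (tr k (\<beta> * u))"
      using \<beta> t_K u two_eq_0 by (subst chi_add) (auto intro!: tr_bit simp del: insert_iff)
    finally show "(\<Sum>x\<in>UNIV. chi (tr k (l * G x) + tr (2 * k) ((a + u) * x)))
        = real q * chi (tr k (\<beta> * t)) * chi (tr k (\<beta> * u))" .
  qed (use \<beta> in \<open>simp_all add: abs_mult abs_chi\<close>)
qed

end

section \<open>Adding a function of traces\<close>

lemma sum_Pow_insert:
  assumes "finite S" "i \<notin> S"
  shows "(\<Sum>J\<in>Pow (insert i S). g J) = (\<Sum>J\<in>Pow S. g J + g (insert i J))"
proof -
  have "(\<Sum>J\<in>Pow (insert i S). g J) = (\<Sum>J\<in>Pow S. g J) + (\<Sum>J\<in>insert i ` Pow S. g J)"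
    unfolding Pow_insert using assms by (intro sum.union_disjoint) auto
  also have "(\<Sum>J\<in>insert i ` Pow S. g J) = (\<Sum>J\<in>Pow S. g (insert i J))"
    using assms by (subst sum.reindex) (auto simp: inj_on_def)
  finally show ?thesis
    by (simp add: sum.distrib)
qed

text \<open>Induction on the variables: \<open>\<psi>\<close> is split into its even part
  (\<open>c0\<close>) and its odd part (\<open>c1\<close>) under toggling \<open>i\<close>.\<close>

lemma fourier_expansion:
  fixes \<psi> :: "'b set \<Rightarrow> real"
  assumes "finite T"
  shows "\<exists>c. \<forall>S\<subseteq>T. \<psi> S = (\<Sum>w\<in>Pow T. c w * (\<Prod>j\<in>w. if j \<in> S then -1 else 1))"
  using assms
proof (induction T arbitrary: \<psi>)
  case empty
  show ?case
    by (intro exI[of _ \<psi>]) auto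
next
  case (insert i T)
  obtain c0 where c0: "\<forall>S\<subseteq>T. (\<psi> S + \<psi> (insert i S)) / 2
      = (\<Sum>w\<in>Pow T. c0 w * (\<Prod>j\<in>w. if j \<in> S then -1 else 1))"
    using insert.IH[of "\<lambda>S. (\<psi> S + \<psi> (insert i S)) / 2"] by blast
  obtain c1 where c1: "\<forall>S\<subseteq>T. (\<psi> S - \<psi> (insert i S)) / 2
      = (\<Sum>w\<in>Pow T. c1 w * (\<Prod>j\<in>w. if j \<in> S then -1 else 1))"
    using insert.IH[of "\<lambda>S. (\<psi> S - \<psi> (insert i S)) / 2"] by blast
  define c where "c w = (if i \<in> w then c1 (w - {i}) else c0 w)" for w
  show ?case
  proof (intro exI[of _ c] allI impI)
    fix S assume S: "S \<subseteq> insert i T"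
    let ?p = "\<lambda>S w. \<Prod>j\<in>w. if j \<in> S then -1 else 1 :: real"
    let ?e = "if i \<in> S then -1 else 1 :: real"
    have p: "?p S w = ?p (S - {i}) w" if "w \<in> Pow T" for w
      using that insert.hyps by (intro prod.cong) auto
    have p': "?p S (insert i w) = ?e * ?p (S - {i}) w" if "w \<in> Pow T" for w
    proof -
      have "finite w" "i \<notin> w"
        using that insert.hyps by (auto intro: finite_subset)
      then show ?thesis
        using p[OF that] by simp
    qed
    have sub: "S - {i} \<subseteq> T"
      using S by auto
    have "(\<Sum>w\<in>Pow (insert i T). c w * ?p S w)
        = (\<Sum>w\<in>Pow T. c w * ?p S w) + (\<Sum>w\<in>Pow T. c (insert i w) * ?p S (insert i w))"
      using insert.hyps by (simp add: sum_Pow_insert sum.distrib)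
    also have "(\<Sum>w\<in>Pow T. c (insert i w) * ?p S (insert i w))
        = (\<Sum>w\<in>Pow T. ?e * (c1 w * ?p (S - {i}) w))"
    proof (rule sum.cong)
      fix w assume w: "w \<in> Pow T"
      then have "insert i w - {i} = w"
        using insert.hyps by auto
      then show "c (insert i w) * ?p S (insert i w) = ?e * (c1 w * ?p (S - {i}) w)"
        unfolding p'[OF w] c_def by simp
    qed simp
    also have "\<dots> = ?e * ((\<psi> (S - {i}) - \<psi> (insert i (S - {i}))) / 2)"
      by (simp only: c1[rule_format, OF sub] sum_distrib_left)
    also have "(\<Sum>w\<in>Pow T. c w * ?p S w) = (\<Sum>w\<in>Pow T. c0 w * ?p (S - {i}) w)"
      using insert.hyps by (intro sum.cong) (auto simp: p c_def)
    also have "\<dots> = (\<psi> (S - {i}) + \<psi> (insert i (S - {i}))) / 2"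
      by (simp only: c0[rule_format, OF sub])
    also have "(\<psi> (S - {i}) + \<psi> (insert i (S - {i}))) / 2
        + ?e * ((\<psi> (S - {i}) - \<psi> (insert i (S - {i}))) / 2) = \<psi> S"
      by (cases "i \<in> S") (simp_all add: insert_absorb field_simps)
    finally show "\<psi> S = (\<Sum>w\<in>Pow (insert i T). c w * ?p S w)"
      by simp
  qed
qed

context quadratic_gf2
begin

section \<open>Sums, products and signs of elements of \<open>{0, 1}\<close>\<close>

lemma bit_sum: "(\<And>i. i \<in> A \<Longrightarrow> f i \<in> {0, 1}) \<Longrightarrow> sum f A \<in> {0, 1::'a}"
proof (induction A rule: infinite_finite_induct)
  case (insert i A)
  have "f i \<in> {0, 1}" "sum f A \<in> {0, 1}"
    using insert by blast+
  then show ?case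
    using insert.hyps by auto
qed simp_all

lemma bit_prod: "(\<And>i. i \<in> A \<Longrightarrow> f i \<in> {0, 1}) \<Longrightarrow> prod f A \<in> {0, 1::'a}"
proof (induction A rule: infinite_finite_induct)
  case (insert i A)
  have "f i \<in> {0, 1}" "prod f A \<in> {0, 1}"
    using insert by blast+
  then show ?case
    using insert.hyps by auto
qed simp_all

lemma reduced_eval_bit:
  assumes "\<And>j. j \<in> {1..m} \<Longrightarrow> X j \<in> {0, 1::'a}"
  shows "reduced_eval m a X \<in> {0, 1}"
  unfolding reduced_eval_def
proof (rule bit_sum)
  fix I assume "I \<in> Pow {1..m}"
  then have "(\<Prod>j\<in>I. X j) \<in> {0, 1}"
    using assms by (intro bit_prod) blast
  then show "(if a I then \<Prod>j\<in>I. X j else 0) \<in> {0, 1}"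
    by simp
qed

lemma reduced_eval_cong:
  assumes "\<And>j. j \<in> {1..m} \<Longrightarrow> X j = Y j"
  shows "reduced_eval m a X = reduced_eval m a Y"
  unfolding reduced_eval_def
proof (rule sum.cong)
  fix I assume "I \<in> Pow {1..m}"
  then have "(\<Prod>j\<in>I. X j) = (\<Prod>j\<in>I. Y j)"
    using assms by (intro prod.cong) auto
  then show "(if a I then \<Prod>j\<in>I. X j else 0) = (if a I then \<Prod>j\<in>I. Y j else 0)"
    by simp
qed simp

lemma chi_sum:
  assumes "\<And>i. i \<in> A \<Longrightarrow> f i \<in> {0, 1::'a}"
  shows "chi (sum f A) = (\<Prod>i\<in>A. chi (f i))"
  using assms
proof (induction A rule: infinite_finite_induct)
  case (insert i A)
  have "chi (f i + sum f A) = chi (f i) * chi (sum f A)"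
    using insert.prems by (intro chi_add two_eq_0 bit_sum) blast+
  then show ?case
    using insert by simp
qed (simp_all add: chi_def)

lemma chi_bit: "chi x = (if x = 1 then -1 else 1)" if "x \<in> {0, 1::'a}"
  using that by (auto simp: chi_def)

end

context niho
begin

lemma vbent_niho_sum_plus:
  assumes w: "\<And>j. j \<in> {1..\<tau>} \<Longrightarrow> w j \<in> K"
  shows "vbent (2 * k) k (\<lambda>x. G x + reduced_eval \<tau> a (\<lambda>j. tr (2 * k) (w j * x)))"
  unfolding vbent_def bent_def
proof (intro ballI allI)
  fix l b :: 'a assume l: "l \<in> K - {0}"
  \<comment> \<open>As a function of the set of variables equal to \<open>1\<close>, the reduced
    polynomial fits the expansion over subsets.\<close>
  define F where "F S = reduced_eval \<tau> a (\<lambda>j. if j \<in> S then 1 else 0 :: 'a)" for S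
  have F_bit: "F S \<in> {0, 1}" for S
    unfolding F_def by (rule reduced_eval_bit) simp
  define X where "X x = {j \<in> {1..\<tau>}. tr (2 * k) (w j * x) = 1}" for x
  have F_X: "reduced_eval \<tau> a (\<lambda>j. tr (2 * k) (w j * x)) = F (X x)" for x
    unfolding F_def
  proof (rule reduced_eval_cong)
    show "tr (2 * k) (w j * x) = (if j \<in> X x then 1 else 0)" if "j \<in> {1..\<tau>}" for j
      using that tr_double_bit[of "w j * x"] by (auto simp: X_def)
  qed
  obtain c where c: "\<And>S. S \<subseteq> {1..\<tau>} \<Longrightarrow>
      chi (tr k (l * F S)) = (\<Sum>v\<in>Pow {1..\<tau>}. c v * (\<Prod>j\<in>v. if j \<in> S then -1 else 1))"
    using fourier_expansion[of "{1..\<tau>}" "\<lambda>S. chi (tr k (l * F S))"] by auto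
  obtain \<beta> W where \<beta>: "\<beta> \<in> K" and W: "\<bar>W\<bar> = real q" and translate:
    "\<And>u. u \<in> K \<Longrightarrow> (\<Sum>x\<in>UNIV. chi (tr k (l * G x) + tr (2 * k) ((b + u) * x)))
      = W * chi (tr k (\<beta> * u))"
    using walsh_niho_sum_translate[OF l] by blast
  \<comment> \<open>\<open>Y\<close> is the point at which the expansion is resummed: translation by
    \<open>w j\<close> multiplies the transform of \<open>G\<close> by \<open>-1\<close> exactly for
    \<open>j \<in> Y\<close>.\<close>
  define Y where "Y = {j \<in> {1..\<tau>}. tr k (\<beta> * w j) = 1}"
  have char_X: "(\<Prod>j\<in>v. if j \<in> X x then -1 else 1) = chi (tr (2 * k) (sum w v * x))"
    if v: "v \<in> Pow {1..\<tau>}" for v x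
  proof -
    have "chi (tr (2 * k) (sum w v * x)) = (\<Prod>j\<in>v. chi (tr (2 * k) (w j * x)))"
      unfolding sum_distrib_right tr_sum by (intro chi_sum tr_double_bit)
    also have "\<dots> = (\<Prod>j\<in>v. if j \<in> X x then -1 else 1)"
    proof (rule prod.cong)
      fix j assume "j \<in> v"
      then show "chi (tr (2 * k) (w j * x)) = (if j \<in> X x then -1 else 1)"
        using v chi_bit[OF tr_double_bit] by (auto simp: X_def)
    qed simp
    finally show ?thesis ..
  qed
  have char_Y: "chi (tr k (\<beta> * sum w v)) = (\<Prod>j\<in>v. if j \<in> Y then -1 else 1)"
    if v: "v \<in> Pow {1..\<tau>}" for v
  proof -
    have bit: "tr k (\<beta> * w j) \<in> {0, 1}" if "j \<in> v" for j
      using that v w \<beta> by (intro tr_bit K_closed) auto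
    then have "chi (tr k (\<beta> * sum w v)) = (\<Prod>j\<in>v. chi (tr k (\<beta> * w j)))"
      unfolding sum_distrib_left tr_sum by (rule chi_sum)
    also have "\<dots> = (\<Prod>j\<in>v. if j \<in> Y then -1 else 1)"
    proof (rule prod.cong)
      fix j assume "j \<in> v"
      then show "chi (tr k (\<beta> * w j)) = (if j \<in> Y then -1 else 1)"
        using v chi_bit[OF bit] by (auto simp: Y_def)
    qed simp
    finally show ?thesis .
  qed
  have "(\<Sum>x\<in>UNIV. chi (tr k (l * (G x + F (X x))) + tr (2 * k) (b * x)))
      = (\<Sum>x\<in>UNIV. \<Sum>v\<in>Pow {1..\<tau>}.
          c v * chi (tr k (l * G x) + tr (2 * k) ((b + sum w v) * x)))"
  proof (rule sum.cong)
    fix x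
    have bits: "tr k (l * G x) \<in> {0, 1}" "tr k (l * F (X x)) \<in> {0, 1}"
      using l niho_sum_in_K bit_in_K[OF F_bit] by (auto intro!: tr_bit simp del: insert_iff)
    have bits': "tr k (l * G x) + tr (2 * k) (b * x) \<in> {0, 1}"
      using bits(1) tr_double_bit[of "b * x"] by auto
    have "chi (tr k (l * (G x + F (X x))) + tr (2 * k) (b * x))
        = chi ((tr k (l * G x) + tr (2 * k) (b * x)) + tr k (l * F (X x)))"
      by (simp add: distrib_left tr_add add_ac)
    also have "\<dots> = chi (tr k (l * G x) + tr (2 * k) (b * x)) * chi (tr k (l * F (X x)))"
      by (rule chi_add[OF two_eq_0 bits' bits(2)])
    also have "chi (tr k (l * F (X x)))
        = (\<Sum>v\<in>Pow {1..\<tau>}. c v * (\<Prod>j\<in>v. if j \<in> X x then -1 else 1))"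
      by (rule c) (auto simp: X_def)
    also have "\<dots> = (\<Sum>v\<in>Pow {1..\<tau>}. c v * chi (tr (2 * k) (sum w v * x)))"
      by (intro sum.cong refl arg_cong2[where f = "(*)"] char_X)
    also have "chi (tr k (l * G x) + tr (2 * k) (b * x)) * \<dots>
        = (\<Sum>v\<in>Pow {1..\<tau>}. c v * chi (tr k (l * G x) + tr (2 * k) ((b + sum w v) * x)))"
      unfolding sum_distrib_left
    proof (rule sum.cong)
      fix v
      have "chi (tr k (l * G x) + tr (2 * k) ((b + sum w v) * x))
          = chi ((tr k (l * G x) + tr (2 * k) (b * x)) + tr (2 * k) (sum w v * x))"
        by (simp add: distrib_right tr_add add_ac)
      also have "\<dots> = chi (tr k (l * G x) + tr (2 * k) (b * x)) * chi (tr (2 * k) (sum w v * x))"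
        by (rule chi_add[OF two_eq_0 bits' tr_double_bit])
      finally show "chi (tr k (l * G x) + tr (2 * k) (b * x)) * (c v * chi (tr (2 * k) (sum w v * x)))
          = c v * chi (tr k (l * G x) + tr (2 * k) ((b + sum w v) * x))"
        by simp
    qed simp
    finally show "chi (tr k (l * (G x + F (X x))) + tr (2 * k) (b * x))
        = (\<Sum>v\<in>Pow {1..\<tau>}. c v * chi (tr k (l * G x) + tr (2 * k) ((b + sum w v) * x)))" .
  qed simp
  also have "\<dots> = (\<Sum>v\<in>Pow {1..\<tau>}. c v *
      (\<Sum>x\<in>UNIV. chi (tr k (l * G x) + tr (2 * k) ((b + sum w v) * x))))"
    by (subst sum.swap) (simp add: sum_distrib_left)
  also have "\<dots> = (\<Sum>v\<in>Pow {1..\<tau>}. W * (c v * (\<Prod>j\<in>v. if j \<in> Y then -1 else 1)))"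
  proof (rule sum.cong)
    fix v assume v: "v \<in> Pow {1..\<tau>}"
    then have "sum w v \<in> K"
      using w by (intro K_sum) auto
    then show "c v * (\<Sum>x\<in>UNIV. chi (tr k (l * G x) + tr (2 * k) ((b + sum w v) * x)))
        = W * (c v * (\<Prod>j\<in>v. if j \<in> Y then -1 else 1))"
      by (simp only: translate char_Y[OF v]) simp
  qed simp
  \<comment> \<open>The expansion is read backwards at \<open>Y\<close>, which leaves a single
    sign.\<close>
  also have "\<dots> = W * chi (tr k (l * F Y))"
    by (subst c) (auto simp: Y_def sum_distrib_left)
  finally show "\<bar>\<Sum>x\<in>UNIV. chi (tr k (l * (G x + reduced_eval \<tau> a (\<lambda>j. tr (2 * k) (w j * x))))
      + tr (2 * k) (b * x))\<bar> = 2 ^ (2 * k div 2)"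
    by (simp add: F_X abs_mult abs_chi W)
qed

end

section \<open>Degree via derivatives\<close>

text \<open>Free of bases and coordinates, this notion applies to the field-valued \<open>G\<close>
  as well as to its Boolean coordinates.\<close>

primrec deriv_deg_le :: "nat \<Rightarrow> ('a::ab_group_add \<Rightarrow> 'b::ab_group_add) \<Rightarrow> bool" where
  "deriv_deg_le 0 f \<longleftrightarrow> (\<forall>x y. f x = f y)"
| "deriv_deg_le (Suc m) f \<longleftrightarrow> (\<forall>a. deriv_deg_le m (\<lambda>x. f (x + a) - f x))"

lemma deriv_deg_le_0D: "deriv_deg_le 0 f \<Longrightarrow> f x = f y"
  unfolding deriv_deg_le.simps by blast

lemma deriv_deg_le_const: "deriv_deg_le m (\<lambda>x. c)"
  by (induction m arbitrary: c) simp_all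

lemma deriv_deg_le_Suc: "deriv_deg_le m f \<Longrightarrow> deriv_deg_le (Suc m) f"
proof (induction m arbitrary: f)
  case 0
  then have "f (x + a) - f x = 0" for x a
    using deriv_deg_le_0D[of f "x + a" x] by simp
  then show ?case
    by simp
next
  case (Suc m)
  have "deriv_deg_le (Suc m) (\<lambda>x. f (x + a) - f x)" for a
    using Suc.prems by (intro Suc.IH) simp
  then show ?case
    by (subst deriv_deg_le.simps) blast
qed

lemma deriv_deg_le_mono: "deriv_deg_le m f \<Longrightarrow> m \<le> m' \<Longrightarrow> deriv_deg_le m' f"
  by (induction m' rule: nat_induct) (auto simp: le_Suc_eq intro: deriv_deg_le_Suc simp del: deriv_deg_le.simps)

lemma deriv_deg_le_shift: "deriv_deg_le m f \<Longrightarrow> deriv_deg_le m (\<lambda>x. f (x + b))"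
proof (induction m arbitrary: f)
  case (Suc m)
  then have "deriv_deg_le m (\<lambda>x. f (x + b + a) - f (x + b))" for a
    using Suc.IH[of "\<lambda>x. f (x + a) - f x"] by simp
  then show ?case
    by (simp add: add_ac)
qed simp

lemma deriv_deg_le_add:
  "deriv_deg_le m f \<Longrightarrow> deriv_deg_le m g \<Longrightarrow> deriv_deg_le m (\<lambda>x. f x + g x)"
proof (induction m arbitrary: f g)
  case 0
  have "f x + g x = f y + g y" for x y
    using deriv_deg_le_0D[OF 0(1), of x y] deriv_deg_le_0D[OF 0(2), of x y] by simp
  then show ?case
    unfolding deriv_deg_le.simps by blast
next
  case (Suc m)
  have "deriv_deg_le m (\<lambda>x. (f (x + a) - f x) + (g (x + a) - g x))" for a
    using Suc by simp
  then show ?case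
    by (simp add: algebra_simps)
qed

lemma deriv_deg_le_sum:
  "(\<And>i. i \<in> A \<Longrightarrow> deriv_deg_le m (f i)) \<Longrightarrow> deriv_deg_le m (\<lambda>x. \<Sum>i\<in>A. f i x)"
  by (induction A rule: infinite_finite_induct)
    (simp_all add: deriv_deg_le_const deriv_deg_le_add)

text \<open>Additivity is asked for on \<open>S\<close> only, because a coordinate with respect to a
  basis of \<open>K\<close> is meaningful only on \<open>K\<close>.\<close>

lemma deriv_deg_le_additive_image:
  assumes "deriv_deg_le m f" "\<And>x. f x \<in> S"
    and "\<And>x y. x \<in> S \<Longrightarrow> y \<in> S \<Longrightarrow> x - y \<in> S"
    and "\<And>x y. x \<in> S \<Longrightarrow> y \<in> S \<Longrightarrow> L (x - y) = L x - L y"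
  shows "deriv_deg_le m (\<lambda>x. L (f x))"
  using assms
proof (induction m arbitrary: f)
  case 0
  have "L (f x) = L (f y)" for x y
    using deriv_deg_le_0D[OF 0(1), of x y] by simp
  then show ?case
    unfolding deriv_deg_le.simps by blast
next
  case (Suc m)
  have "deriv_deg_le m (\<lambda>x. L (f (x + a) - f x))" for a
    using Suc.prems by (intro Suc.IH) auto
  then show ?case
    using Suc.prems by simp
qed

lemma deriv_deg_le_mult_const:
  fixes f :: "'a::ab_group_add \<Rightarrow> 'b::comm_ring_1"
  shows "deriv_deg_le m f \<Longrightarrow> deriv_deg_le m (\<lambda>x. f x * c)"
  by (rule deriv_deg_le_additive_image[where S = UNIV]) (auto simp: left_diff_distrib)

text \<open>Product rule: the difference along \<open>a\<close> is
  \<open>(f (x + a) - f x) * L x + f (x + a) * L a\<close>, where induction covers the first term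
  and \<open>L a\<close> is constant.\<close>

lemma deriv_deg_le_mult_additive:
  fixes f L :: "'a::ab_group_add \<Rightarrow> 'b::comm_ring_1"
  assumes L: "additive L" and "deriv_deg_le m f"
  shows "deriv_deg_le (Suc m) (\<lambda>x. f x * L x)"
  using assms(2)
proof (induction m arbitrary: f)
  case 0
  have "f = (\<lambda>_. f 0)"
    using deriv_deg_le_0D[OF 0] by (intro ext)
  then obtain c where "f = (\<lambda>_. c)"
    by blast
  then show ?case
    by (simp add: additive.add[OF L] algebra_simps)
next
  case (Suc m)
  have "deriv_deg_le (Suc m) (\<lambda>x. (f (x + a) - f x) * L x + f (x + a) * L a)" for a
    using Suc.prems
    by (intro deriv_deg_le_add Suc.IH deriv_deg_le_mult_const deriv_deg_le_shift[of "Suc m"]) simp_all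
  moreover have "(f (x + a) - f x) * L x + f (x + a) * L a = f (x + a) * L (x + a) - f x * L x" for x a
    by (simp add: additive.add[OF L] algebra_simps)
  ultimately have "deriv_deg_le (Suc m) (\<lambda>x. f (x + a) * L (x + a) - f x * L x)" for a
    by (simp only:)
  then show ?case
    by (subst deriv_deg_le.simps) blast
qed

lemma deriv_deg_le_prod_additive:
  fixes L :: "'i \<Rightarrow> 'a::ab_group_add \<Rightarrow> 'b::comm_ring_1"
  assumes "finite A" "\<And>i. i \<in> A \<Longrightarrow> additive (L i)"
  shows "deriv_deg_le (card A) (\<lambda>x. \<Prod>i\<in>A. L i x)"
  using assms
proof (induction A rule: finite_induct)
  case (insert i A)
  then have "deriv_deg_le (Suc (card A)) (\<lambda>x. (\<Prod>i\<in>A. L i x) * L i x)"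
    by (intro deriv_deg_le_mult_additive) simp_all
  then show ?case
    using insert.hyps by (simp add: mult.commute del: deriv_deg_le.simps)
qed simp

text \<open>Since \<open>(A + B) ^ 2 = A ^ 2 + B ^ 2\<close>, each binary digit of an exponent contributes one
  additive factor; the exponents \<open>i\<close> and \<open>2 ^ r - 1 - i\<close> have complementary digits.\<close>
lemma deriv_deg_le_complementary_powers:
  fixes A B :: "'a::ab_group_add \<Rightarrow> 'b::comm_ring_1"
  assumes two: "(2::'b) = 0" and "additive A" "additive B" "i < 2 ^ r"
  shows "deriv_deg_le r (\<lambda>x. A x ^ i * B x ^ (2 ^ r - 1 - i))"
  using assms(2-)
proof (induction r arbitrary: i A B)
  case (Suc r)
  let ?A = "\<lambda>x. (A x)\<^sup>2" and ?B = "\<lambda>x. (B x)\<^sup>2"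
  have add: "additive ?A" "additive ?B"
    using Suc.prems two by (simp_all add: additive_def power2_sum)
  \<comment> \<open>\<open>j\<close> drops the last binary digit of \<open>i\<close>; that digit
    decides whether \<open>A\<close> or \<open>B\<close> is left as a single factor.\<close>
  define j where "j = i div 2"
  have j: "j < 2 ^ r"
    using Suc.prems by (simp add: j_def less_mult_imp_div_less)
  have IH: "deriv_deg_le r (\<lambda>x. ?A x ^ j * ?B x ^ (2 ^ r - 1 - j))"
    by (rule Suc.IH[OF add j])
  show ?case
  proof (cases "even i")
    case True
    then have i: "i = 2 * j"
      by (simp add: j_def)
    then have "2 ^ Suc r - 1 - i = Suc (2 * (2 ^ r - 1 - j))"
      using j by (simp add: diff_mult_distrib2)
    then have "A x ^ i * B x ^ (2 ^ Suc r - 1 - i) = ?A x ^ j * ?B x ^ (2 ^ r - 1 - j) * B x" for x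
      unfolding i by (simp add: power_mult)
    then show ?thesis
      using deriv_deg_le_mult_additive[OF Suc.prems(2) IH] by (simp only:)
  next
    case False
    then have i: "i = Suc (2 * j)"
      by (simp add: j_def)
    then have "2 ^ Suc r - 1 - i = 2 * (2 ^ r - 1 - j)"
      using j by (simp add: diff_mult_distrib2)
    then have "A x ^ i * B x ^ (2 ^ Suc r - 1 - i) = ?A x ^ j * ?B x ^ (2 ^ r - 1 - j) * A x" for x
      unfolding i by (simp add: power_mult)
    then show ?thesis
      using deriv_deg_le_mult_additive[OF Suc.prems(1) IH] by (simp only:)
  qed
qed simp

text \<open>An even \<open>i\<close> passes to the squares of \<open>A\<close> and \<open>B\<close>.
  For odd \<open>i\<close> both exponents have last digit \<open>1\<close> and otherwise
  complementary digits, which costs one extra factor.\<close>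

lemma deriv_deg_le_power_pair:
  fixes A B :: "'a::ab_group_add \<Rightarrow> 'b::comm_ring_1"
  assumes two: "(2::'b) = 0" and "additive A" "additive B" "0 < i" "i < 2 ^ r"
  shows "deriv_deg_le (Suc r) (\<lambda>x. A x ^ i * B x ^ (2 ^ r - i))"
  using assms(2-)
proof (induction r arbitrary: i A B)
  case (Suc r)
  let ?A = "\<lambda>x. (A x)\<^sup>2" and ?B = "\<lambda>x. (B x)\<^sup>2"
  have add: "additive ?A" "additive ?B"
    using Suc.prems two by (simp_all add: additive_def power2_sum)
  define j where "j = i div 2"
  have j: "j < 2 ^ r"
    using Suc.prems by (simp add: j_def less_mult_imp_div_less)
  show ?case
  proof (cases "even i")
    case True
    then have i: "i = 2 * j"
      by (simp add: j_def)
    then have "2 ^ Suc r - i = 2 * (2 ^ r - j)"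
      by (simp add: diff_mult_distrib2)
    then have "A x ^ i * B x ^ (2 ^ Suc r - i) = ?A x ^ j * ?B x ^ (2 ^ r - j)" for x
      unfolding i by (simp add: power_mult)
    moreover have "deriv_deg_le (Suc r) (\<lambda>x. ?A x ^ j * ?B x ^ (2 ^ r - j))"
      using Suc.prems i j by (intro Suc.IH[OF add]) simp_all
    ultimately show ?thesis
      using deriv_deg_le_Suc by (simp only:)
  next
    case False
    then have i: "i = Suc (2 * j)"
      by (simp add: j_def)
    then have "2 ^ Suc r - i = Suc (2 * (2 ^ r - 1 - j))"
      using j by (simp add: diff_mult_distrib2)
    then have "A x ^ i * B x ^ (2 ^ Suc r - i) = ?A x ^ j * ?B x ^ (2 ^ r - 1 - j) * A x * B x" for x
      unfolding i by (simp add: power_mult)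
    moreover have "deriv_deg_le (Suc (Suc r)) (\<lambda>x. ?A x ^ j * ?B x ^ (2 ^ r - 1 - j) * A x * B x)"
      using Suc.prems
      by (intro deriv_deg_le_mult_additive deriv_deg_le_complementary_powers[OF two add j])
    ultimately show ?thesis
      by (simp only:)
  qed
qed simp

text \<open>In characteristic two the sum over all subsets is an iterated derivative, one for each
  index; more than \<open>m\<close> of them annihilate \<open>f\<close>.\<close>

lemma deriv_deg_le_subset_sum:
  fixes f :: "'a::ab_group_add \<Rightarrow> 'b::comm_ring_1"
  assumes two: "(2::'b) = 0" and "finite I" "deriv_deg_le m f" "m < card I"
  shows "(\<Sum>J\<in>Pow I. f (y + sum v J)) = 0"
  using assms(2-)
proof (induction I arbitrary: f m rule: finite_induct)
  case (insert i I)
  let ?D = "\<lambda>x. f (x + v i) - f x"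
  have "(\<Sum>J\<in>Pow (insert i I). f (y + sum v J))
      = (\<Sum>J\<in>Pow I. f (y + sum v J) + f (y + sum v (insert i J)))"
    by (rule sum_Pow_insert[OF insert.hyps])
  also have "\<dots> = (\<Sum>J\<in>Pow I. ?D (y + sum v J))"
  proof (rule sum.cong)
    fix J assume "J \<in> Pow I"
    then have "finite J" "i \<notin> J"
      using insert.hyps by (auto intro: finite_subset)
    then have step: "y + sum v (insert i J) = y + sum v J + v i"
      by (simp add: add_ac)
    have "a + a = 0" for a :: 'b
      using two by (metis mult_2 mult_zero_left)
    then have "a + b = b - a" for a b :: 'b
      by (metis add_diff_cancel_right' add.assoc add_0_right add.commute)
    then show "f (y + sum v J) + f (y + sum v (insert i J)) = ?D (y + sum v J)"
      unfolding step .
  qed simp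
  also have "\<dots> = 0"
  proof (cases m)
    case 0
    then have "f (x + v i) = f x" for x
      using insert.prems deriv_deg_le_0D[of f "x + v i" x] by simp
    then show ?thesis
      by simp
  next
    case (Suc m')
    then show ?thesis
      using insert.prems insert.hyps by (intro insert.IH[of m']) simp_all
  qed
  finally show ?case .
qed simp

text \<open>Each \<open>h J\<close> occurs \<open>2 ^ card (S - J)\<close> times, an even number
  unless \<open>J = S\<close>.\<close>

lemma moebius_Pow:
  fixes h :: "'i set \<Rightarrow> 'b::comm_ring_1"
  assumes two: "(2::'b) = 0" and "finite S"
  shows "(\<Sum>I\<in>Pow S. \<Sum>J\<in>Pow I. h J) = h S"
  using assms(2)
proof (induction S arbitrary: h rule: finite_induct)
  case (insert i S)
  have "a + (a + b) = b" for a b :: 'b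
    using two by (metis mult_2 mult_zero_left add.assoc add_0)
  moreover have "(\<Sum>J\<in>Pow (insert i I). h J) = (\<Sum>J\<in>Pow I. h J) + (\<Sum>J\<in>Pow I. h (insert i J))"
    if "I \<in> Pow S" for I
  proof -
    have "finite I" "i \<notin> I"
      using that insert.hyps by (auto intro: finite_subset)
    then show ?thesis
      by (simp add: sum_Pow_insert sum.distrib)
  qed
  ultimately have "(\<Sum>I\<in>Pow (insert i S). \<Sum>J\<in>Pow I. h J) = (\<Sum>I\<in>Pow S. \<Sum>J\<in>Pow I. h (insert i J))"
    using insert.hyps by (simp add: sum_Pow_insert)
  then show ?case
    using insert.IH[of "\<lambda>J. h (insert i J)"] by simp
qed simp

section \<open>Algebraic normal forms\<close>

lemma lincomb_eq_sum:
  assumes "c \<in> coeffvecs m"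
  shows "lincomb m v c = sum v {i. c i}"
proof -
  have "{i. c i} \<subseteq> {1..m}"
    using assms by (auto simp: coeffvecs_def)
  then have inter: "{1..m} \<inter> {i. c i} = {i. c i}"
    by blast
  have "lincomb m v c = sum v ({1..m} \<inter> {i. c i})"
    unfolding lincomb_def by (subst sum.inter_restrict) simp_all
  then show ?thesis
    by (simp only: inter)
qed

lemma bij_betw_coeffvecs: "bij_betw (\<lambda>J i. i \<in> J) (Pow {1..m}) (coeffvecs m)"
  by (rule bij_betw_byWitness[where f' = "\<lambda>c. {i. c i}"]) (auto simp: coeffvecs_def)

lemma lincomb_set: "J \<in> Pow {1..m} \<Longrightarrow> lincomb m v (\<lambda>i. i \<in> J) = sum v J"
  by (subst lincomb_eq_sum) (auto simp: coeffvecs_def)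

text \<open>Supports replace coefficient vectors, so that bases can be handled through subset
  sums.\<close>

lemma bij_betw_lincomb_iff:
  "bij_betw (lincomb m v) (coeffvecs m) S \<longleftrightarrow> bij_betw (sum v) (Pow {1..m}) S"
proof -
  have "bij_betw (lincomb m v) (coeffvecs m) S
      \<longleftrightarrow> bij_betw (lincomb m v \<circ> (\<lambda>J i. i \<in> J)) (Pow {1..m}) S"
    by (rule bij_betw_comp_iff[OF bij_betw_coeffvecs])
  also have "\<dots> \<longleftrightarrow> bij_betw (sum v) (Pow {1..m}) S"
    by (intro bij_betw_cong) (simp add: lincomb_set)
  finally show ?thesis .
qed

lemma is_basisD:
  assumes "is_basis m S v"
  shows "\<And>i. i \<in> {1..m} \<Longrightarrow> v i \<in> S" "bij_betw (sum v) (Pow {1..m}) S"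
  using assms by (simp_all add: is_basis_def bij_betw_lincomb_iff)

lemma coord_sum:
  assumes v: "is_basis m S v" and J: "J \<in> Pow {1..m}"
  shows "coord m v (sum v J) i \<longleftrightarrow> i \<in> J"
proof -
  have "coord m v (sum v J) = (\<lambda>i. i \<in> J)"
    unfolding coord_def
  proof (rule the_equality)
    show "(\<lambda>i. i \<in> J) \<in> coeffvecs m \<and> lincomb m v (\<lambda>i. i \<in> J) = sum v J"
      using J lincomb_set[OF J] by (auto simp: coeffvecs_def)
    fix c assume c: "c \<in> coeffvecs m \<and> lincomb m v c = sum v J"
    then have "sum v {i. c i} = sum v J" "{i. c i} \<in> Pow {1..m}"
      by (auto simp: lincomb_eq_sum coeffvecs_def)
    then have "{i. c i} = J"
      using is_basisD(2)[OF v] J unfolding bij_betw_def by (metis inj_onD)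
    then show "c = (\<lambda>i. i \<in> J)"
      by auto
  qed
  then show ?thesis
    by simp
qed

lemma basis_expansion:
  assumes "is_basis m S v" "x \<in> S"
  obtains J where "J \<in> Pow {1..m}" "x = sum v J"
  using assms is_basisD(2)[OF assms(1)] unfolding bij_betw_def by blast

context quadratic_gf2
begin

lemma sum_sym_diff:
  fixes v :: "nat \<Rightarrow> 'a"
  assumes "finite A" "finite B"
  shows "sum v (sym_diff A B) = sum v A + sum v B"
proof -
  have "sum v A = sum v (A - B) + sum v (A \<inter> B)"
    using assms by (metis sum.Int_Diff add.commute)
  moreover have "sum v B = sum v (B - A) + sum v (A \<inter> B)"
    using assms by (metis sum.Int_Diff add.commute Int_commute)
  moreover have "sum v (sym_diff A B) = sum v (A - B) + sum v (B - A)"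
    using assms by (intro sum.union_disjoint) auto
  ultimately show ?thesis
    by (simp add: add_ac)
qed

text \<open>Greedy choice: \<open>m\<close> vectors have at most \<open>2 ^ m\<close> subset sums,
  so some \<open>z\<close> lies outside and can be appended.\<close>

lemma sum_independent:
  assumes "m \<le> 2 * k"
  shows "\<exists>v::nat \<Rightarrow> 'a. inj_on (sum v) (Pow {1..m})"
  using assms
proof (induction m)
  case (Suc m)
  then obtain v :: "nat \<Rightarrow> 'a" where v: "inj_on (sum v) (Pow {1..m})"
    by auto
  have "card (sum v ` Pow {1..m}) \<le> card (Pow {1..m})"
    by (intro card_image_le) simp
  also have "\<dots> = 2 ^ m"
    by (simp add: card_Pow)
  also have "\<dots> < card (UNIV :: 'a set)"
    using Suc.prems unfolding card_field by (intro power_strict_increasing) auto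
  finally have "sum v ` Pow {1..m} \<noteq> UNIV"
    by auto
  then obtain z where z: "z \<notin> sum v ` Pow {1..m}"
    by auto
  define w where "w = v(Suc m := z)"
  have w: "sum w J = sum v (J - {Suc m}) + (if Suc m \<in> J then z else 0)"
    if "J \<in> Pow {1..Suc m}" for J
  proof -
    have J: "finite J"
      using that by (auto intro: finite_subset)
    have low: "sum w (J - {Suc m}) = sum v (J - {Suc m})"
      by (intro sum.cong) (auto simp: w_def)
    show ?thesis
    proof (cases "Suc m \<in> J")
      case True
      have "sum w J = w (Suc m) + sum w (J - {Suc m})"
        by (rule sum.remove[OF J True])
      then show ?thesis
        using True unfolding low by (simp add: w_def add.commute)
    next
      case False
      then show ?thesis
        using low by simp
    qed
  qed
  have low: "J - {Suc m} \<in> Pow {1..m}" if "J \<in> Pow {1..Suc m}" for J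
    using that by auto
  have no: "sum v A + z \<noteq> sum v B" if AB: "A \<in> Pow {1..m}" "B \<in> Pow {1..m}" for A B
  proof
    assume "sum v A + z = sum v B"
    then have "z = sum v A + sum v B"
      by (metis add_self_left)
    also have "\<dots> = sum v (sym_diff A B)"
      using AB by (intro sum_sym_diff[symmetric]) (auto intro: finite_subset)
    finally show False
      using z AB by blast
  qed
  have "inj_on (sum w) (Pow {1..Suc m})"
  proof (rule inj_onI)
    fix A B assume AB: "A \<in> Pow {1..Suc m}" "B \<in> Pow {1..Suc m}" "sum w A = sum w B"
    have "Suc m \<in> A \<longleftrightarrow> Suc m \<in> B"
      using AB(3) no[OF low[OF AB(1)] low[OF AB(2)]] no[OF low[OF AB(2)] low[OF AB(1)]]
      unfolding w[OF AB(1)] w[OF AB(2)] by (auto split: if_splits)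
    moreover from this have "A - {Suc m} = B - {Suc m}"
      using AB(3) inj_onD[OF v _ low[OF AB(1)] low[OF AB(2)]]
      unfolding w[OF AB(1)] w[OF AB(2)] by (auto split: if_splits)
    ultimately show "A = B"
      by blast
  qed
  then show ?case
    by blast
qed simp

lemma ex_basis: "\<exists>v::nat \<Rightarrow> 'a. is_basis (2 * k) UNIV v"
proof -
  obtain v :: "nat \<Rightarrow> 'a" where v: "inj_on (sum v) (Pow {1..2 * k})"
    using sum_independent by blast
  have "card (sum v ` Pow {1..2 * k}) = card (UNIV :: 'a set)"
    using card_image[OF v] by (simp add: card_Pow card_field)
  then have "sum v ` Pow {1..2 * k} = UNIV"
    by (intro card_subset_eq) simp_all
  then have "bij_betw (sum v) (Pow {1..2 * k}) UNIV"
    using v unfolding bij_betw_def by blast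
  then show ?thesis
    unfolding is_basis_def bij_betw_lincomb_iff by blast
qed

lemma additive_coord:
  fixes v :: "nat \<Rightarrow> 'a"
  assumes v: "is_basis m S v" and xy: "x \<in> S" "y \<in> S"
  shows "(if coord m v (x + y) i then 1 else 0 :: 'a)
    = (if coord m v x i then 1 else 0) + (if coord m v y i then 1 else 0)"
proof -
  obtain A where A: "A \<in> Pow {1..m}" "x = sum v A"
    using basis_expansion[OF v xy(1)] .
  obtain B where B: "B \<in> Pow {1..m}" "y = sum v B"
    using basis_expansion[OF v xy(2)] .
  have "finite A" "finite B"
    using A B by (auto intro: finite_subset)
  then have "x + y = sum v (sym_diff A B)"
    by (simp only: sum_sym_diff A B)
  moreover have "sym_diff A B \<in> Pow {1..m}"
    using A B by auto
  ultimately show ?thesis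
    using A B by (auto simp: coord_sum[OF v] simp del: Pow_iff)
qed

lemma reduced_eval_indicator:
  assumes "S \<subseteq> {1..m}"
  shows "reduced_eval m a (\<lambda>j. if j \<in> S then 1 else 0 :: 'a) = (\<Sum>I\<in>Pow S. of_bool (a I))"
proof -
  have "(\<Prod>j\<in>I. if j \<in> S then 1 else 0 :: 'a) = of_bool (I \<subseteq> S)" if "I \<in> Pow {1..m}" for I
  proof -
    have "finite I"
      using that by (auto intro: finite_subset)
    then show ?thesis
      by (auto simp: prod_zero_iff subset_iff intro!: prod.neutral)
  qed
  then have "reduced_eval m a (\<lambda>j. if j \<in> S then 1 else 0 :: 'a)
      = (\<Sum>I\<in>Pow {1..m}. if I \<subseteq> S then of_bool (a I) else 0)"
    unfolding reduced_eval_def by (intro sum.cong) auto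
  also have "\<dots> = (\<Sum>I\<in>Pow S. of_bool (a I))"
    using assms by (intro sum.mono_neutral_cong_right) auto
  finally show ?thesis .
qed

text \<open>The Moebius transform of \<open>f\<close> along subset sums, which yields the
  coefficients of its algebraic normal form.\<close>

definition anf :: "nat \<Rightarrow> (nat \<Rightarrow> 'a) \<Rightarrow> ('a \<Rightarrow> 'a) \<Rightarrow> nat set \<Rightarrow> bool" where
  "anf m v f I \<longleftrightarrow> I \<subseteq> {1..m} \<and> (\<Sum>J\<in>Pow I. f (sum v J)) = 1"

text \<open>Moebius inversion in both directions; this identifies the polynomial selected by the
  description in \<open>bool_deg\<close>.\<close>

lemma anf_unique:
  assumes v: "is_basis m UNIV v" and f: "\<And>x. f x \<in> {0, 1}"
  shows "(is_reduced m a \<and> (\<forall>x. f x = reduced_eval m a (\<lambda>j. if coord m v x j then 1 else 0)))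
    \<longleftrightarrow> a = anf m v f"
proof -
  have eval: "reduced_eval m a (\<lambda>j. if coord m v (sum v S) j then 1 else 0 :: 'a)
      = (\<Sum>I\<in>Pow S. of_bool (a I))" if "S \<in> Pow {1..m}" for S a
    using that by (simp only: coord_sum[OF v that] reduced_eval_indicator Pow_iff)
  have all: "(\<forall>x. Q x) \<longleftrightarrow> (\<forall>S\<in>Pow {1..m}. Q (sum v S))" for Q :: "'a \<Rightarrow> bool"
    using basis_expansion[OF v] by (metis UNIV_I)
  show ?thesis
  proof
    assume a: "is_reduced m a \<and> (\<forall>x. f x = reduced_eval m a (\<lambda>j. if coord m v x j then 1 else 0))"
    have "a I \<longleftrightarrow> anf m v f I" if I: "I \<in> Pow {1..m}" for I
    proof -
      have "(\<Sum>J\<in>Pow I. f (sum v J)) = (\<Sum>J\<in>Pow I. \<Sum>I\<in>Pow J. of_bool (a I))"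
      proof (rule sum.cong)
        fix J assume "J \<in> Pow I"
        then have J: "J \<in> Pow {1..m}"
          using I by auto
        show "f (sum v J) = (\<Sum>I\<in>Pow J. of_bool (a I))"
          using a eval[OF J] by simp
      qed simp
      also have "\<dots> = of_bool (a I)"
        using I by (intro moebius_Pow two_eq_0) (auto intro: finite_subset)
      finally show ?thesis
        using I by (simp add: anf_def)
    qed
    moreover have "\<not> a I" "\<not> anf m v f I" if "I \<notin> Pow {1..m}" for I
      using that a by (auto simp: is_reduced_def anf_def)
    ultimately show "a = anf m v f"
      by (intro ext) blast
  next
    assume a: "a = anf m v f"
    have on_sums: "f (sum v S) = (\<Sum>I\<in>Pow S. of_bool (a I))" if S: "S \<in> Pow {1..m}" for S
    proof -
      have "of_bool (a I) = (\<Sum>J\<in>Pow I. f (sum v J))" if "I \<in> Pow S" for I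
      proof -
        have "I \<subseteq> {1..m}"
          using that S by auto
        moreover have "(\<Sum>J\<in>Pow I. f (sum v J)) \<in> {0, 1}"
          using f by (intro bit_sum)
        ultimately show ?thesis
          by (auto simp: a anf_def)
      qed
      then have "(\<Sum>I\<in>Pow S. of_bool (a I)) = (\<Sum>I\<in>Pow S. \<Sum>J\<in>Pow I. f (sum v J))"
        by (intro sum.cong) simp_all
      also have "\<dots> = f (sum v S)"
        using S by (intro moebius_Pow two_eq_0) (auto intro: finite_subset)
      finally show ?thesis ..
    qed
    have "\<forall>x. f x = reduced_eval m a (\<lambda>j. if coord m v x j then 1 else 0)"
      unfolding all
    proof
      fix S assume S: "S \<in> Pow {1..m}"
      show "f (sum v S) = reduced_eval m a (\<lambda>j. if coord m v (sum v S) j then 1 else 0)"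
        unfolding eval[OF S] by (rule on_sums[OF S])
    qed
    then show "is_reduced m a \<and> (\<forall>x. f x = reduced_eval m a (\<lambda>j. if coord m v x j then 1 else 0))"
      by (simp add: is_reduced_def a anf_def)
  qed
qed

lemma poly_deg_le_iff: "poly_deg m a \<le> d \<longleftrightarrow> (\<forall>I. I \<subseteq> {1..m} \<longrightarrow> a I \<longrightarrow> card I \<le> d)"
proof -
  have "finite ({card I | I. I \<in> Pow {1..m} \<and> a I} \<union> {0})"
    by simp
  then show ?thesis
    unfolding poly_deg_def by (subst Max_le_iff) auto
qed

text \<open>Coordinates are additive, so a monomial has degree at most its number of factors.
  Conversely, a coefficient of the normal form is a subset sum of \<open>f\<close>, which vanishes
  when \<open>card I > d\<close>.\<close>

lemma bool_deg_le_iff: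
  fixes v :: "nat \<Rightarrow> 'a"
  assumes v: "is_basis m UNIV v" and f: "\<And>x. f x \<in> {0, 1}"
  shows "bool_deg m v f \<le> d \<longleftrightarrow> deriv_deg_le d f"
proof -
  have deg: "bool_deg m v f = poly_deg m (anf m v f)"
    unfolding bool_deg_def anf_unique[of m v f, OF v f] by simp
  show ?thesis
  proof
    assume d: "bool_deg m v f \<le> d"
    let ?b = "\<lambda>j x. if coord m v x j then 1 else 0 :: 'a"
    have b: "additive (?b j)" for j
      using additive_coord[OF v] by (simp add: additive_def)
    have "deriv_deg_le d (\<lambda>x. if anf m v f I then \<Prod>j\<in>I. ?b j x else 0)"
      if I: "I \<in> Pow {1..m}" for I
    proof (cases "anf m v f I")
      case True
      have "finite I"
        using I by (auto intro: finite_subset)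
      then have "deriv_deg_le (card I) (\<lambda>x. \<Prod>j\<in>I. ?b j x)"
        using b by (intro deriv_deg_le_prod_additive)
      moreover have "card I \<le> d"
        using d I True unfolding deg poly_deg_le_iff by blast
      ultimately show ?thesis
        using True deriv_deg_le_mono by auto
    qed (simp add: deriv_deg_le_const)
    then have anf_deg: "deriv_deg_le d (\<lambda>x. reduced_eval m (anf m v f) (\<lambda>j. ?b j x))"
      unfolding reduced_eval_def by (rule deriv_deg_le_sum)
    have "f x = reduced_eval m (anf m v f) (\<lambda>j. ?b j x)" for x
      using anf_unique[of m v f "anf m v f", OF v f] by blast
    then have "f = (\<lambda>x. reduced_eval m (anf m v f) (\<lambda>j. ?b j x))"
      by (rule ext)
    then show "deriv_deg_le d f"
      using anf_deg by (rule ssubst[where P = "deriv_deg_le d"])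
  next
    assume d: "deriv_deg_le d f"
    have "card I \<le> d" if "anf m v f I" for I
    proof (rule ccontr)
      assume "\<not> card I \<le> d"
      moreover have "finite I"
        using that by (auto simp: anf_def intro: finite_subset)
      ultimately have "(\<Sum>J\<in>Pow I. f (0 + sum v J)) = 0"
        using d by (intro deriv_deg_le_subset_sum[OF two_eq_0]) auto
      then show False
        using that by (simp add: anf_def)
    qed
    then show "bool_deg m v f \<le> d"
      unfolding deg poly_deg_le_iff by blast
  qed
qed

end

section \<open>Degrees of the vectorial functions\<close>

context quadratic_gf2
begin

text \<open>By nondegeneracy, an element of \<open>K\<close> is determined by its traces against a
  basis; there are \<open>2 ^ k\<close> patterns, so each occurs. The factor
  \<open>\<theta>\<close>, with \<open>\<theta> + conj \<theta> = 1\<close>, carries this to the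
  trace of the whole field.\<close>

lemma ex_trace_pattern:
  assumes u: "is_basis k K u"
  shows "\<exists>x. \<forall>j\<in>{1..k}. tr (2 * k) (u j * x) = (if j \<in> T then 1 else 0 :: 'a)"
proof -
  have u_K: "u j \<in> K" if "j \<in> {1..k}" for j
    using is_basisD(1)[OF u that] .
  define \<Phi> where "\<Phi> z = {j \<in> {1..k}. tr k (u j * z) = 1}" for z
  have "inj_on \<Phi> K"
  proof (rule inj_onI)
    fix z z' assume z: "z \<in> K" "z' \<in> K" and eq: "\<Phi> z = \<Phi> z'"
    have "tr k (u j * (z + z')) = 0" if j: "j \<in> {1..k}" for j
    proof -
      have "tr k (u j * z) \<in> {0, 1}" "tr k (u j * z') \<in> {0, 1}"
        using tr_bit[OF K_closed(4)[OF u_K[OF j]]] z by blast+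
      moreover have "tr k (u j * z) = 1 \<longleftrightarrow> tr k (u j * z') = 1"
        using eq j by (auto simp: \<Phi>_def)
      ultimately show ?thesis
        by (auto simp: distrib_left tr_add)
    qed
    then have zero: "tr k (sum u J * (z + z')) = 0" if "J \<in> Pow {1..k}" for J
      unfolding sum_distrib_right tr_sum using that by (intro sum.neutral) blast
    show "z = z'"
    proof (rule ccontr)
      assume "z \<noteq> z'"
      then have "z + z' \<noteq> 0"
        by (simp add: add_eq_0_iff_eq)
      then obtain y where y: "y \<in> K" "tr k (y * (z + z')) = 1"
        using tr_nondegenerate z K_closed(3) by metis
      obtain J where "J \<in> Pow {1..k}" "y = sum u J"
        using basis_expansion[OF u y(1)] .
      then show False
        using zero y(2) by simp
    qed
  qed
  then have "card (\<Phi> ` K) = card (Pow {1..k})"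
    by (simp add: card_image card_K card_Pow)
  moreover have "\<Phi> ` K \<subseteq> Pow {1..k}"
    by (auto simp: \<Phi>_def)
  ultimately have "\<Phi> ` K = Pow {1..k}"
    by (intro card_subset_eq) simp_all
  moreover have "T \<inter> {1..k} \<in> Pow {1..k}"
    by auto
  ultimately obtain z where z: "z \<in> K" "\<Phi> z = T \<inter> {1..k}"
    by (metis imageE)
  obtain \<theta> :: 'a where \<theta>: "\<theta> + conj \<theta> = 1"
    using ex_theta by blast
  have "tr (2 * k) (u j * (z * \<theta>)) = (if j \<in> T then 1 else 0)" if j: "j \<in> {1..k}" for j
  proof -
    have "u j * (z * \<theta>) + conj (u j * (z * \<theta>)) = u j * z * (\<theta> + conj \<theta>)"
      using u_K[OF j] z(1) by (simp add: K_iff power_mult_distrib distrib_left mult.assoc)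
    then have "tr (2 * k) (u j * (z * \<theta>)) = tr k (u j * z)"
      unfolding tr_double \<theta> by simp
    moreover have "tr k (u j * z) \<in> {0, 1}"
      using tr_bit[OF K_closed(4)[OF u_K[OF j]]] z by blast
    moreover have "j \<in> \<Phi> z \<longleftrightarrow> j \<in> T \<inter> {1..k}"
      by (simp only: z(2))
    then have "tr k (u j * z) = 1 \<longleftrightarrow> j \<in> T"
      using j unfolding \<Phi>_def by blast
    ultimately show ?thesis
      by auto
  qed
  then show ?thesis
    by blast
qed

lemma deriv_deg_le_reduced_eval:
  fixes w :: "nat \<Rightarrow> 'a"
  shows "deriv_deg_le m (\<lambda>x. reduced_eval m a (\<lambda>j. tr n (w j * x)))"
  unfolding reduced_eval_def
proof (rule deriv_deg_le_sum)
  fix I assume I: "I \<in> Pow {1..m}"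
  then have "deriv_deg_le (card I) (\<lambda>x. \<Prod>j\<in>I. tr n (w j * x))"
    by (intro deriv_deg_le_prod_additive)
      (auto simp: additive_def distrib_left tr_add intro: finite_subset)
  moreover have "card I \<le> m"
    using I card_mono[of "{1..m}" I] by simp
  ultimately have "deriv_deg_le m (\<lambda>x. \<Prod>j\<in>I. tr n (w j * x))"
    by (rule deriv_deg_le_mono)
  then show "deriv_deg_le m (\<lambda>x. if a I then \<Prod>j\<in>I. tr n (w j * x) else 0)"
    by (cases "a I") (simp_all add: deriv_deg_le_const)
qed

text \<open>Summing over the span of a family dual to the forms \<open>x \<mapsto> tr (u (idx j) * x)\<close> picks out the
  coefficient of the top monomial.\<close>
lemma not_deriv_deg_le_reduced_eval:
  assumes u: "is_basis k K u" and idx: "idx ` {1..k} \<subseteq> {1..k}" "inj_on idx {1..k}"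
    and a: "a {1..k}" and m: "m < k"
  shows "\<not> deriv_deg_le m (\<lambda>x. reduced_eval k a (\<lambda>j. tr (2 * k) (u (idx j) * x :: 'a)))"
    (is "\<not> deriv_deg_le m ?F")
proof
  assume deg: "deriv_deg_le m ?F"
  obtain e where e: "\<And>i j. j \<in> {1..k} \<Longrightarrow> tr (2 * k) (u j * e i) = (if j = idx i then 1 else 0 :: 'a)"
    using ex_trace_pattern[OF u, of "{idx _}"] by (metis singleton_iff)
  have "(\<Sum>J\<in>Pow {1..k}. ?F (0 + sum e J)) = 0"
    using deg m by (intro deriv_deg_le_subset_sum[OF two_eq_0]) auto
  \<comment> \<open>By duality and injectivity of \<open>idx\<close>, the forms take the indicator
    of \<open>J\<close> as their values at \<open>sum e J\<close>.\<close>
  moreover have "?F (0 + sum e J) = (\<Sum>I\<in>Pow J. of_bool (a I))" if J: "J \<in> Pow {1..k}" for J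
  proof -
    have "tr (2 * k) (u (idx j) * sum e J) = (if j \<in> J then 1 else 0)" if j: "j \<in> {1..k}" for j
    proof -
      have "tr (2 * k) (u (idx j) * sum e J) = (\<Sum>i\<in>J. if idx j = idx i then 1 else 0)"
        using j idx by (simp only: sum_distrib_left tr_sum) (intro sum.cong e; blast)
      also have "\<dots> = (\<Sum>i\<in>J. if j = i then 1 else 0)"
        using idx(2) j J by (intro sum.cong) (auto dest: inj_onD)
      also have "\<dots> = (if j \<in> J then 1 else 0)"
        using J by (subst sum.delta') (auto intro: finite_subset)
      finally show ?thesis .
    qed
    then have "?F (0 + sum e J) = reduced_eval k a (\<lambda>j. if j \<in> J then 1 else 0)"
      by (intro reduced_eval_cong) simp
    then show ?thesis
      using J by (simp add: reduced_eval_indicator)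
  qed
  ultimately have "(\<Sum>J\<in>Pow {1..k}. \<Sum>I\<in>Pow J. of_bool (a I)) = (0::'a)"
    by simp
  then show False
    using a moebius_Pow[OF two_eq_0, of "{1..k}" "\<lambda>I. of_bool (a I)"] by simp
qed

text \<open>Under the bound \<open>k\<close> on all coordinates, the maximum is \<open>k\<close> iff
  some coordinate exceeds \<open>k - 1\<close>, which derivatives can express.\<close>

lemma vec_deg_eq_iff:
  fixes F :: "'a \<Rightarrow> 'a"
  assumes deg: "\<And>i. i \<in> {1..k} \<Longrightarrow> deriv_deg_le k (\<lambda>x. if coord k u (F x) i then 1 else 0 :: 'a)"
  shows "vec_deg (2 * k) k u F = k
    \<longleftrightarrow> (\<exists>i\<in>{1..k}. \<not> deriv_deg_le (k - 1) (\<lambda>x. if coord k u (F x) i then 1 else 0 :: 'a))"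
proof -
  define v where "v = (SOME v::nat \<Rightarrow> 'a. is_basis (2 * k) UNIV v)"
  let ?f = "\<lambda>i x. if coord k u (F x) i then 1 else 0 :: 'a"
  let ?D = "(\<lambda>i. bool_deg (2 * k) v (?f i)) ` {1..k}"
  have v: "is_basis (2 * k) UNIV v"
    unfolding v_def using ex_basis by (rule someI_ex)
  have iff: "bool_deg (2 * k) v (?f i) \<le> d \<longleftrightarrow> deriv_deg_le d (?f i)" for i d
    by (rule bool_deg_le_iff[OF v]) simp
  have D: "finite ?D" "?D \<noteq> {}"
    using k_pos by auto
  have le: "b \<le> k" if "b \<in> ?D" for b
    using that deg iff by auto
  have "vec_deg (2 * k) k u F = k \<longleftrightarrow> k \<in> ?D"
    unfolding vec_deg_def v_def[symmetric] Setcompr_eq_image using D le by (metis (no_types, lifting) Max_eqI Max_in)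
  also have "\<dots> \<longleftrightarrow> (\<exists>i\<in>{1..k}. bool_deg (2 * k) v (?f i) = k)"
    unfolding image_iff by (rule bex_cong[OF refl]) (rule eq_commute)
  also have "\<dots> \<longleftrightarrow> (\<exists>i\<in>{1..k}. \<not> bool_deg (2 * k) v (?f i) \<le> k - 1)"
  proof (rule bex_cong)
    fix i assume i: "i \<in> {1..k}"
    have "bool_deg (2 * k) v (?f i) \<le> k"
      using iff deg[OF i] by blast
    then show "bool_deg (2 * k) v (?f i) = k \<longleftrightarrow> \<not> bool_deg (2 * k) v (?f i) \<le> k - 1"
      using k_pos by linarith
  qed simp
  finally show ?thesis
    unfolding iff .
qed

end

context niho
begin

lemma deriv_deg_le_niho_sum: "deriv_deg_le (Suc r) G"
proof -
  have "additive (\<lambda>x. conj x ^ P)" "additive (\<lambda>x::'a. x ^ P)"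
    by (simp_all add: additive_def frob_add)
  then have "deriv_deg_le (Suc r) (\<lambda>x. \<Sum>i\<in>{1..Q - 1}. (conj x ^ P) ^ i * (x ^ P) ^ (Q - i))"
    by (intro deriv_deg_le_sum deriv_deg_le_power_pair[OF two_eq_0]) auto
  moreover have "G = (\<lambda>x. \<Sum>i\<in>{1..Q - 1}. (conj x ^ P) ^ i * (x ^ P) ^ (Q - i))"
    by (rule ext) (rule niho_sum_geometric)
  ultimately show ?thesis
    by (simp only:)
qed

text \<open>In a coordinate where \<open>1\<close> does not vanish, \<open>F\<close> is the sum of
  the coordinates of \<open>G x + F x\<close> and \<open>G x\<close>, so these cannot both have
  degree below \<open>k\<close>.\<close>

lemma vec_deg_niho_sum_plus:
  assumes u: "is_basis k K u" and idx: "idx ` {1..k} \<subseteq> {1..k}" "inj_on idx {1..k}"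
    and a: "a {1..k}" and G: "vec_deg (2 * k) k u G \<noteq> k"
  shows "vec_deg (2 * k) k u (\<lambda>x. G x + reduced_eval k a (\<lambda>j. tr (2 * k) (u (idx j) * x))) = k"
proof -
  define F where "F x = reduced_eval k a (\<lambda>j. tr (2 * k) (u (idx j) * x))" for x
  define \<pi> where "\<pi> i y = (if coord k u y i then 1 else 0 :: 'a)" for i y
  have F_bit: "F x \<in> {0, 1}" for x
    unfolding F_def by (intro reduced_eval_bit tr_double_bit)
  have \<pi>_add: "\<pi> i (x + y) = \<pi> i x + \<pi> i y" if "x \<in> K" "y \<in> K" for i x y
    unfolding \<pi>_def by (rule additive_coord[OF u that])
  have \<pi>_G: "deriv_deg_le m (\<lambda>x. \<pi> i (G x))" if "deriv_deg_le m G" for i m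
    using that niho_sum_in_K by (rule deriv_deg_le_additive_image) (simp_all add: \<pi>_add)
  \<comment> \<open>As \<open>F\<close> takes only the values \<open>0\<close> and \<open>1\<close>,
    its coordinates are multiples of those of \<open>1\<close>.\<close>
  have \<pi>_H: "\<pi> i (G x + F x) = \<pi> i (G x) + F x * \<pi> i 1" for i x
  proof -
    have "\<pi> i 0 = 0"
      using \<pi>_add[of 0 0 i] by simp
    then have "\<pi> i (F x) = F x * \<pi> i 1"
      using F_bit[of x] by auto
    then show ?thesis
      using \<pi>_add[OF niho_sum_in_K bit_in_K[OF F_bit]] by simp
  qed
  have G_k: "deriv_deg_le k (\<lambda>x. \<pi> i (G x))" for i
    using r by (intro \<pi>_G deriv_deg_le_mono[OF deriv_deg_le_niho_sum]) simp
  have F_k: "deriv_deg_le k F"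
    unfolding F_def by (rule deriv_deg_le_reduced_eval)
  have H_k: "deriv_deg_le k (\<lambda>x. \<pi> i (G x + F x))" for i
    unfolding \<pi>_H by (intro deriv_deg_le_add deriv_deg_le_mult_const G_k F_k)
  obtain J where J: "J \<in> Pow {1..k}" "1 = sum u J"
    using basis_expansion[OF u] K_closed(2) by blast
  have "J \<noteq> {}"
    using J(2) by auto
  then obtain i where i: "i \<in> J" "i \<in> {1..k}"
    using J(1) by blast
  have "coord k u 1 i"
    using coord_sum[OF u J(1), of i] i(1) unfolding J(2)[symmetric] by blast
  then have "\<pi> i 1 = 1"
    by (simp add: \<pi>_def)
  then have F_eq: "F x = \<pi> i (G x + F x) + \<pi> i (G x)" for x
    unfolding \<pi>_H by (simp add: add_ac)
  have G_low: "deriv_deg_le (k - 1) (\<lambda>x. \<pi> i (G x))"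
    using vec_deg_eq_iff[of u G] G G_k i unfolding \<pi>_def by blast
  have "\<not> deriv_deg_le (k - 1) (\<lambda>x. \<pi> i (G x + F x))"
  proof
    assume "deriv_deg_le (k - 1) (\<lambda>x. \<pi> i (G x + F x))"
    then have "deriv_deg_le (k - 1) (\<lambda>x. \<pi> i (G x + F x) + \<pi> i (G x))"
      using G_low by (rule deriv_deg_le_add)
    then have "deriv_deg_le (k - 1) F"
      by (simp only: F_eq[symmetric])
    moreover have "\<not> deriv_deg_le (k - 1) F"
      unfolding F_def using u idx a
      by (rule not_deriv_deg_le_reduced_eval[where u = u and idx = idx and a = a and m = "k - 1"])
        (use k_pos in simp)
    ultimately show False
      by blast
  qed
  then show ?thesis
    using vec_deg_eq_iff[of u "\<lambda>x. G x + F x"] H_k i unfolding \<pi>_def F_def by blast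
qed

end

theorem theorem6:
  fixes n k \<tau> r d :: nat
    and u :: "nat \<Rightarrow> 'a::{field,finite}"
    and idx :: "nat \<Rightarrow> nat"
    and a :: "nat set \<Rightarrow> bool"
    and G H :: "'a \<Rightarrow> 'a"
  assumes card: "card (UNIV :: 'a set) = 2 ^ n"
    and nk: "n = 2 * k"
    and tau: "1 \<le> \<tau>" "\<tau> \<le> k"
    and rr: "1 < r" "r < k" "gcd r k = 1"
    and basis: "is_basis k (subfld k) u"
    and G_def: "G = (\<lambda>x. \<Sum>i\<in>{1..2 ^ r - 1}. x ^ ((i * 2 ^ (k - r) + 1) * (2 ^ k - 1) + 1))"
    and red: "is_reduced \<tau> a"
    and deg: "d = poly_deg \<tau> a"
    and idx: "idx ` {1..\<tau>} \<subseteq> {1..k}" "inj_on idx {1..\<tau>}"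
    and H_def: "H = (\<lambda>x. G x + reduced_eval \<tau> a (\<lambda>j. tr n (u (idx j) * x)))"
  shows "vbent n k H \<and> (d = k \<and> vec_deg n k u G \<noteq> k \<longrightarrow> vec_deg n k u H = k)"
proof -
  interpret niho k "TYPE('a)" r
    using card nk rr by unfold_locales auto
  have G: "G = niho_sum k r"
    unfolding G_def niho_sum_def ..
  have "u (idx j) \<in> subfld k" if "j \<in> {1..\<tau>}" for j
    using is_basisD(1)[OF basis] idx(1) that by blast
  then have "vbent n k H"
    unfolding H_def G nk by (rule vbent_niho_sum_plus)
  moreover have "vec_deg n k u H = k" if "d = k" "vec_deg n k u G \<noteq> k"
  proof -
    \<comment> \<open>Degree \<open>k\<close> in \<open>\<tau> \<le> k\<close> variables forces
      \<open>\<tau> = k\<close> and the presence of the full monomial.\<close>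
    have "\<not> poly_deg \<tau> a \<le> k - 1"
      using that deg k_pos by simp
    then obtain I where I: "I \<subseteq> {1..\<tau>}" "a I" "\<not> card I \<le> k - 1"
      unfolding poly_deg_le_iff by blast
    then have "card I \<le> \<tau>"
      using card_mono[of "{1..\<tau>}" I] by simp
    then have \<tau>: "\<tau> = k"
      using I tau by simp
    then have "I = {1..k}"
      using I card_seteq[of "{1..\<tau>}" I] by simp
    then show ?thesis
      using I that idx basis unfolding H_def G nk \<tau> by (intro vec_deg_niho_sum_plus) simp_all
  qed
  ultimately show ?thesis
    by blast
qed

end
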